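(* Let $K$ be a finite skew brace acting trivially on abelian groups $A$ and $B$. Let $[(\alpha,\mu)]\in \mathrm{H}^2_b(K,A)$ and $[(\beta,\nu)]\in \mathrm{H}^2_b(K,B)$, with corresponding annihilator extension skew braces $G=A\times_{(\alpha,\mu)}K$ and $H=B\times_{(\beta,\nu)}K$ respectively. Then $G$ and $H$ are isoclinic if $\varepsilon_G(\hat A)=\varepsilon_H(\hat B)$ (as subgroups of $\mathrm{H}^2_b(K,\mathbb{C}^\times)$).
   Context: A skew (left) brace is a set $A$ with two group structures $(A,\cdot)$, $(A,\circ)$ such that $a\circ(b\cdot c)=(a\circ b)\cdot a^{-1}\cdot(a\circ c)$ for all $a,b,c$, where $a^{-1}$ is the inverse in $(A,\cdot)$. The two identities coincide, denoted $1$. Put $\lambda_a(b)=a^{-1}\cdot(a\circ b)$, $a*b=\lambda_a(b)\cdot b^{-1}$, $[a,b]^{\cdot}=a\cdot b\cdot a^{-1}\cdot b^{-1}$. Brace homomorphisms preserve both operations. An abelian group is viewed as a trivial brace (both operations equal). An ideal is a subgroup of $(A,\cdot)$ stable under all $\lambda_a$ and normal in both groups. $\mathrm{Ann}(A)=\{a\in A: a*b=b*a=[a,b]^{\cdot}=1\ \forall b\in A\}$ (an ideal). $\Gamma_2(A)$ is the subgroup of $(A,\cdot)$ generated by all $a*b$ and $[a,b]^{\cdot}$, $a,b\in A$ (an ideal). Isoclinism: skew braces $A,B$ are isoclinic if there are brace isomorphisms $\xi:A/\mathrm{Ann}(A)\to B/\mathrm{Ann}(B)$ and $\theta:\Gamma_2(A)\to\Gamma_2(B)$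 such that $\theta([a_1,a_2]^{\cdot})=[b_1,b_2]^{\cdot}$ and $\theta(a_1*a_2)=b_1*b_2$ for all $a_i\in A$, $b_i\in B$ with $\xi(\mathrm{Ann}(A)a_i)=\mathrm{Ann}(B)b_i$, $i=1,2$. Cohomology (trivial action): for a skew brace $K$ and an abelian group $A$ (written multiplicatively), a $2$-cocycle is a pair of maps $\alpha,\mu:K\times K\to A$ such that for all $x,y,z\in K$: $\alpha(1,y)=\alpha(x,1)=1$; $\mu(1,y)=\mu(x,1)=1$; $\alpha(y,z)\alpha(x\cdot y,z)^{-1}\alpha(x,y\cdot z)\alpha(x,y)^{-1}=1$; $\mu(y,z)\mu(x\circ y,z)^{-1}\mu(x,y\circ z)\mu(x,y)^{-1}=1$; $\alpha(y,z)\alpha(x\circ y,\lambda_x(z))^{-1}\alpha(x,\lambda_x(z))=\mu(x,y)\mu(x,y\cdot z)^{-1}\mu(x,z)$. It is a $2$-coboundary if there is $h:K\to A$ with $h(1)=1$, $\alpha(x,y)=h(x)h(y)h(x\cdot y)^{-1}$ and $\mu(x,y)=h(x)h(y)h(x\circ y)^{-1}$ for all $x,y$. $\mathrm{H}^2_b(K,A)$ is the group of $2$-cocycles (under pointwise product) modulo $2$-coboundaries. $A\times_{(\alpha,\mu)}K$ is the skew brace on $A\times K$ with $(a_1,k_1)\cdot(a_2,k_2)=(a_1a_2\alpha(k_1,k_2),k_1\cdot k_2)$ and $(a_1,k_1)\circ(a_2,k_2)=(a_1a_2\mu(k_1,k_2),k_1\circ k_2)$. For an abelian group $A$, $\hat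 A=\mathrm{Hom}(A,\mathbb{C}^\times)$. For $G=A\times_{(\alpha,\mu)}K$, the homomorphism $\varepsilon_G:\hat A\to \mathrm{H}^2_b(K,\mathbb{C}^\times)$ is $\varepsilon_G(\lambda)=[(\lambda\circ\alpha,\lambda\circ\mu)]$ (composition of maps); $\varepsilon_H$ is defined likewise from $(\beta,\nu)$. *)

theory Defs
  imports Complex_Main "HOL-Algebra.Generated_Groups"
begin

section \<open>Skew braces\<close>

text \<open>
  The inherited monoid operation is the dot operation of the skew brace. Both groups
  share the field \<open>one\<close>, since their identities necessarily coincide.
\<close>

record 'a skew_brace = "'a monoid" +
  circ :: "'a \<Rightarrow> 'a \<Rightarrow> 'a"  (infixl "\<circ>\<index>" 70)

definition circ_group :: "('a, 'm) skew_brace_scheme \<Rightarrow> 'a monoid" where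
  "circ_group A = \<lparr>carrier = carrier A, mult = circ A, one = one A\<rparr>"

locale skew_brace = dot: group A + circle: group "circ_group A"
  for A :: "('a, 'm) skew_brace_scheme" (structure) +
  assumes brace_distrib:
    "\<lbrakk>a \<in> carrier A; b \<in> carrier A; c \<in> carrier A\<rbrakk>
      \<Longrightarrow> a \<circ>\<^bsub>A\<^esub> (b \<otimes> c) = (a \<circ>\<^bsub>A\<^esub> b) \<otimes> inv a \<otimes> (a \<circ>\<^bsub>A\<^esub> c)"

definition brace_lambda :: "('a, 'm) skew_brace_scheme \<Rightarrow> 'a \<Rightarrow> 'a \<Rightarrow> 'a" where
  "brace_lambda A a b = inv\<^bsub>A\<^esub> a \<otimes>\<^bsub>A\<^esub> (a \<circ>\<^bsub>A\<^esub> b)"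

definition brace_star :: "('a, 'm) skew_brace_scheme \<Rightarrow> 'a \<Rightarrow> 'a \<Rightarrow> 'a" where
  "brace_star A a b = brace_lambda A a b \<otimes>\<^bsub>A\<^esub> inv\<^bsub>A\<^esub> b"

definition dot_commutator :: "('a, 'm) monoid_scheme \<Rightarrow> 'a \<Rightarrow> 'a \<Rightarrow> 'a" where
  "dot_commutator A a b = a \<otimes>\<^bsub>A\<^esub> b \<otimes>\<^bsub>A\<^esub> inv\<^bsub>A\<^esub> a \<otimes>\<^bsub>A\<^esub> inv\<^bsub>A\<^esub> b"

definition annihilator :: "('a, 'm) skew_brace_scheme \<Rightarrow> 'a set" where
  "annihilator A = {a \<in> carrier A. \<forall>b \<in> carrier A.
     brace_star A a b = \<one>\<^bsub>A\<^esub> \<and> brace_star A b a = \<one>\<^bsub>A\<^esub> \<and> dot_commutator A a b = \<one>\<^bsub>A\<^esub>}"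

definition Gamma2 :: "('a, 'm) skew_brace_scheme \<Rightarrow> 'a set" where
  "Gamma2 A = generate A
     ({brace_star A a b | a b. a \<in> carrier A \<and> b \<in> carrier A} \<union>
      {dot_commutator A a b | a b. a \<in> carrier A \<and> b \<in> carrier A})"

text \<open>
  For an ideal \<open>I\<close>, the cosets of \<open>I\<close> in the two groups agree, so that the elementwise
  products of cosets give both operations of the quotient brace.
\<close>

definition quotient_brace :: "('a, 'm) skew_brace_scheme \<Rightarrow> 'a set \<Rightarrow> 'a set skew_brace" where
  "quotient_brace A I =
     \<lparr>carrier = rcosets\<^bsub>A\<^esub> I, mult = set_mult A, one = I, circ = set_mult (circ_group A)\<rparr>"

definition brace_iso ::
    "('a, 'm) skew_brace_scheme \<Rightarrow> ('b, 'n) skew_brace_scheme \<Rightarrow> ('a \<Rightarrow> 'b) set" where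
  "brace_iso A B = {f. f \<in> hom A B \<and> f \<in> hom (circ_group A) (circ_group B) \<and>
     bij_betw f (carrier A) (carrier B)}"

definition isoclinic ::
    "('a, 'm) skew_brace_scheme \<Rightarrow> ('b, 'n) skew_brace_scheme \<Rightarrow> bool" where
  "isoclinic A B \<longleftrightarrow>
     (\<exists>\<xi> \<in> brace_iso (quotient_brace A (annihilator A)) (quotient_brace B (annihilator B)).
      \<exists>\<theta> \<in> brace_iso (A\<lparr>carrier := Gamma2 A\<rparr>) (B\<lparr>carrier := Gamma2 B\<rparr>).
      \<forall>a1 \<in> carrier A. \<forall>a2 \<in> carrier A. \<forall>b1 \<in> carrier B. \<forall>b2 \<in> carrier B.
        \<xi> (annihilator A #>\<^bsub>A\<^esub> a1) = annihilator B #>\<^bsub>B\<^esub> b1 \<and>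
        \<xi> (annihilator A #>\<^bsub>A\<^esub> a2) = annihilator B #>\<^bsub>B\<^esub> b2 \<longrightarrow>
        \<theta> (dot_commutator A a1 a2) = dot_commutator B b1 b2 \<and>
        \<theta> (brace_star A a1 a2) = brace_star B b1 b2)"


section \<open>Second cohomology with trivial action\<close>

text \<open>
  Cochains are extensional functions on \<open>K \<times> K\<close>, so that two cochains are equal as soon
  as they agree on the carrier.
\<close>

definition cocycles2 ::
    "('k, 'm) skew_brace_scheme \<Rightarrow> ('a, 'n) monoid_scheme
      \<Rightarrow> (('k \<times> 'k \<Rightarrow> 'a) \<times> ('k \<times> 'k \<Rightarrow> 'a)) set" where
  "cocycles2 K A = {(\<alpha>, \<mu>).
     \<alpha> \<in> carrier K \<times> carrier K \<rightarrow>\<^sub>E carrier A \<and>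
     \<mu> \<in> carrier K \<times> carrier K \<rightarrow>\<^sub>E carrier A \<and>
     (\<forall>x \<in> carrier K. \<alpha> (\<one>\<^bsub>K\<^esub>, x) = \<one>\<^bsub>A\<^esub> \<and> \<alpha> (x, \<one>\<^bsub>K\<^esub>) = \<one>\<^bsub>A\<^esub> \<and>
                      \<mu> (\<one>\<^bsub>K\<^esub>, x) = \<one>\<^bsub>A\<^esub> \<and> \<mu> (x, \<one>\<^bsub>K\<^esub>) = \<one>\<^bsub>A\<^esub>) \<and>
     (\<forall>x \<in> carrier K. \<forall>y \<in> carrier K. \<forall>z \<in> carrier K.
        \<alpha> (y, z) \<otimes>\<^bsub>A\<^esub> inv\<^bsub>A\<^esub> \<alpha> (x \<otimes>\<^bsub>K\<^esub> y, z) \<otimes>\<^bsub>A\<^esub> \<alpha> (x, y \<otimes>\<^bsub>K\<^esub> z) \<otimes>\<^bsub>A\<^esub> inv\<^bsub>A\<^esub> \<alpha> (x, y) = \<one>\<^bsub>A\<^esub> \<and>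
        \<mu> (y, z) \<otimes>\<^bsub>A\<^esub> inv\<^bsub>A\<^esub> \<mu> (x \<circ>\<^bsub>K\<^esub> y, z) \<otimes>\<^bsub>A\<^esub> \<mu> (x, y \<circ>\<^bsub>K\<^esub> z) \<otimes>\<^bsub>A\<^esub> inv\<^bsub>A\<^esub> \<mu> (x, y) = \<one>\<^bsub>A\<^esub> \<and>
        \<alpha> (y, z) \<otimes>\<^bsub>A\<^esub> inv\<^bsub>A\<^esub> \<alpha> (x \<circ>\<^bsub>K\<^esub> y, brace_lambda K x z) \<otimes>\<^bsub>A\<^esub> \<alpha> (x, brace_lambda K x z)
          = \<mu> (x, y) \<otimes>\<^bsub>A\<^esub> inv\<^bsub>A\<^esub> \<mu> (x, y \<otimes>\<^bsub>K\<^esub> z) \<otimes>\<^bsub>A\<^esub> \<mu> (x, z))}"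

definition cocycle_group ::
    "('k, 'm) skew_brace_scheme \<Rightarrow> ('a, 'n) monoid_scheme
      \<Rightarrow> (('k \<times> 'k \<Rightarrow> 'a) \<times> ('k \<times> 'k \<Rightarrow> 'a)) monoid" where
  "cocycle_group K A =
     \<lparr>carrier = cocycles2 K A,
      mult = (\<lambda>(\<alpha>, \<mu>) (\<beta>, \<nu>).
        (\<lambda>p \<in> carrier K \<times> carrier K. \<alpha> p \<otimes>\<^bsub>A\<^esub> \<beta> p,
         \<lambda>p \<in> carrier K \<times> carrier K. \<mu> p \<otimes>\<^bsub>A\<^esub> \<nu> p)),
      one = (\<lambda>p \<in> carrier K \<times> carrier K. \<one>\<^bsub>A\<^esub>, \<lambda>p \<in> carrier K \<times> carrier K. \<one>\<^bsub>A\<^esub>)\<rparr>"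

definition coboundaries2 ::
    "('k, 'm) skew_brace_scheme \<Rightarrow> ('a, 'n) monoid_scheme
      \<Rightarrow> (('k \<times> 'k \<Rightarrow> 'a) \<times> ('k \<times> 'k \<Rightarrow> 'a)) set" where
  "coboundaries2 K A =
     {(\<lambda>(x, y) \<in> carrier K \<times> carrier K. h x \<otimes>\<^bsub>A\<^esub> h y \<otimes>\<^bsub>A\<^esub> inv\<^bsub>A\<^esub> h (x \<otimes>\<^bsub>K\<^esub> y),
       \<lambda>(x, y) \<in> carrier K \<times> carrier K. h x \<otimes>\<^bsub>A\<^esub> h y \<otimes>\<^bsub>A\<^esub> inv\<^bsub>A\<^esub> h (x \<circ>\<^bsub>K\<^esub> y)) | h.
      h \<in> carrier K \<rightarrow> carrier A \<and> h \<one>\<^bsub>K\<^esub> = \<one>\<^bsub>A\<^esub>}"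

definition H2b ::
    "('k, 'm) skew_brace_scheme \<Rightarrow> ('a, 'n) monoid_scheme
      \<Rightarrow> (('k \<times> 'k \<Rightarrow> 'a) \<times> ('k \<times> 'k \<Rightarrow> 'a)) set monoid" where
  "H2b K A = cocycle_group K A Mod coboundaries2 K A"

definition cohomology_class ::
    "('k, 'm) skew_brace_scheme \<Rightarrow> ('a, 'n) monoid_scheme
      \<Rightarrow> ('k \<times> 'k \<Rightarrow> 'a) \<times> ('k \<times> 'k \<Rightarrow> 'a)
      \<Rightarrow> (('k \<times> 'k \<Rightarrow> 'a) \<times> ('k \<times> 'k \<Rightarrow> 'a)) set" where
  "cohomology_class K A c = coboundaries2 K A #>\<^bsub>cocycle_group K A\<^esub> c"

definition annihilator_extension ::
    "('a, 'n) monoid_scheme \<Rightarrow> ('k, 'm) skew_brace_scheme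
      \<Rightarrow> ('k \<times> 'k \<Rightarrow> 'a) \<times> ('k \<times> 'k \<Rightarrow> 'a) \<Rightarrow> ('a \<times> 'k) skew_brace" where
  "annihilator_extension A K = (\<lambda>(\<alpha>, \<mu>).
     \<lparr>carrier = carrier A \<times> carrier K,
      mult = (\<lambda>(a1, k1) (a2, k2). (a1 \<otimes>\<^bsub>A\<^esub> a2 \<otimes>\<^bsub>A\<^esub> \<alpha> (k1, k2), k1 \<otimes>\<^bsub>K\<^esub> k2)),
      one = (\<one>\<^bsub>A\<^esub>, \<one>\<^bsub>K\<^esub>),
      circ = (\<lambda>(a1, k1) (a2, k2). (a1 \<otimes>\<^bsub>A\<^esub> a2 \<otimes>\<^bsub>A\<^esub> \<mu> (k1, k2), k1 \<circ>\<^bsub>K\<^esub> k2))\<rparr>)"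


section \<open>Characters\<close>

definition complex_units :: "complex monoid" where
  "complex_units = \<lparr>carrier = UNIV - {0}, mult = (*), one = 1\<rparr>"

definition characters :: "('a, 'n) monoid_scheme \<Rightarrow> ('a \<Rightarrow> complex) set" where
  "characters A = hom A complex_units"

definition eps ::
    "('k, 'm) skew_brace_scheme \<Rightarrow> ('k \<times> 'k \<Rightarrow> 'a) \<times> ('k \<times> 'k \<Rightarrow> 'a)
      \<Rightarrow> ('a \<Rightarrow> complex) \<Rightarrow> (('k \<times> 'k \<Rightarrow> complex) \<times> ('k \<times> 'k \<Rightarrow> complex)) set" where
  "eps K = (\<lambda>(\<alpha>, \<mu>) \<chi>. cohomology_class K complex_units
     (\<lambda>p \<in> carrier K \<times> carrier K. \<chi> (\<alpha> p), \<lambda>p \<in> carrier K \<times> carrier K. \<chi> (\<mu> p)))"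

end

theory Submission
  imports Defs
begin

text \<open>
  The two extensions \<open>G\<close> and \<open>H\<close> of \<open>K\<close> are compared through their fibre product
  \<open>E = G \<times>\<^sub>K H\<close>, which is the annihilator extension of \<open>K\<close> by \<open>A \<times> B\<close> with the cocycle
  \<open>((\<alpha>, \<beta>), (\<mu>, \<nu>))\<close>. It projects onto \<open>G\<close> and onto \<open>H\<close>, and the claim is that each projection
  is injective on \<open>Gamma2 E\<close>.

  Given this, the isoclinism is formal (\<open>isoclinic_span\<close>). Each projection restricts to an isomorphism on
  \<open>Gamma2\<close>, and since an element annihilates as soon as certain elements of \<open>Gamma2\<close> are trivial,
  each projection also identifies the quotients by the annihilators. Commutators and star
  products correspond because they are images of the same expressions in \<open>E\<close>.

  An element of \<open>Gamma2 E\<close> in the kernel of the projection to \<open>G\<close> has the form \<open>((1, b), 1)\<close>. Let \<open>\<eta>\<close> be a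
  character of \<open>B\<close>. By hypothesis some character \<open>\<chi>\<close> of \<open>A\<close> gives the same class in the second
  cohomology of \<open>K\<close>, so that \<open>\<chi> \<circ> \<alpha>\<close> and \<open>\<eta> \<circ> \<beta>\<close>, as well as \<open>\<chi> \<circ> \<mu>\<close> and \<open>\<eta> \<circ> \<nu>\<close>, differ by the
  coboundary of one cochain \<open>h\<close>. Then \<open>((a, b), x) \<mapsto> \<chi> a h(x) / \<eta> b\<close> is a brace homomorphism from
  \<open>E\<close> to an abelian group, which must be trivial on \<open>Gamma2 E\<close>; hence \<open>\<eta> b = 1\<close>
  (\<open>Gamma2_characters_agree\<close>). As \<open>\<eta>\<close> was arbitrary and the nonzero complex numbers form a divisible group,
  \<open>b = 1\<close> (\<open>characters_separate_points\<close>).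
\<close>

section \<open>Annihilator and derived ideal of a skew brace\<close>

lemma circ_group_simps [simp]:
  "carrier (circ_group A) = carrier A" "mult (circ_group A) = circ A"
  "one (circ_group A) = one A"
  by (simp_all add: circ_group_def)

context skew_brace
begin

lemma circ_closed [simp, intro]:
  "\<lbrakk>a \<in> carrier A; b \<in> carrier A\<rbrakk> \<Longrightarrow> a \<circ>\<^bsub>A\<^esub> b \<in> carrier A"
  using circle.m_closed by simp

lemma circ_assoc:
  "\<lbrakk>a \<in> carrier A; b \<in> carrier A; c \<in> carrier A\<rbrakk>
    \<Longrightarrow> (a \<circ>\<^bsub>A\<^esub> b) \<circ>\<^bsub>A\<^esub> c = a \<circ>\<^bsub>A\<^esub> (b \<circ>\<^bsub>A\<^esub> c)"
  using circle.m_assoc by simp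

lemma circ_one [simp]:
  assumes "a \<in> carrier A"
  shows "\<one> \<circ>\<^bsub>A\<^esub> a = a" "a \<circ>\<^bsub>A\<^esub> \<one> = a"
  using assms circle.l_one circle.r_one by simp_all

lemma brace_lambda_closed [simp, intro]:
  "\<lbrakk>a \<in> carrier A; b \<in> carrier A\<rbrakk> \<Longrightarrow> brace_lambda A a b \<in> carrier A"
  by (simp add: brace_lambda_def)

lemma mult_brace_lambda:
  "\<lbrakk>a \<in> carrier A; b \<in> carrier A\<rbrakk> \<Longrightarrow> a \<otimes> brace_lambda A a b = a \<circ>\<^bsub>A\<^esub> b"
  by (simp add: brace_lambda_def dot.m_assoc[symmetric])

lemma brace_star_closed [simp, intro]:
  "\<lbrakk>a \<in> carrier A; b \<in> carrier A\<rbrakk> \<Longrightarrow> brace_star A a b \<in> carrier A"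
  by (simp add: brace_star_def)

lemma dot_commutator_closed [simp, intro]:
  "\<lbrakk>a \<in> carrier A; b \<in> carrier A\<rbrakk> \<Longrightarrow> dot_commutator A a b \<in> carrier A"
  by (simp add: dot_commutator_def)

lemma circ_eq_mult_star:
  assumes "a \<in> carrier A" "b \<in> carrier A"
  shows "a \<circ>\<^bsub>A\<^esub> b = a \<otimes> brace_star A a b \<otimes> b"
  using assms by (simp add: brace_star_def dot.m_assoc mult_brace_lambda)

lemma brace_star_unique:
  assumes "a \<in> carrier A" "b \<in> carrier A" "c \<in> carrier A"
  shows "brace_star A a b = c \<longleftrightarrow> a \<circ>\<^bsub>A\<^esub> b = a \<otimes> c \<otimes> b"
  using assms by (simp add: circ_eq_mult_star)

lemma dot_commutator_unique:
  assumes "a \<in> carrier A" "b \<in> carrier A" "c \<in> carrier A"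
  shows "dot_commutator A a b = c \<longleftrightarrow> a \<otimes> b = c \<otimes> (b \<otimes> a)"
proof -
  have "dot_commutator A a b = (a \<otimes> b) \<otimes> inv (b \<otimes> a)"
    using assms by (simp add: dot_commutator_def dot.m_assoc dot.inv_mult_group)
  with assms show ?thesis
    by (metis dot.inv_solve_right dot.m_closed)
qed

text \<open>
  An annihilating element acts by translations in both groups alike. In this form it can be
  moved through products, which is how it disappears from commutators and star products.
\<close>

lemma annihilator_iff:
  "z \<in> annihilator A \<longleftrightarrow> z \<in> carrier A \<and>
    (\<forall>b \<in> carrier A. z \<circ>\<^bsub>A\<^esub> b = z \<otimes> b \<and> b \<circ>\<^bsub>A\<^esub> z = b \<otimes> z \<and> z \<otimes> b = b \<otimes> z)"
  by (auto simp: annihilator_def brace_star_unique dot_commutator_unique)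

lemma annihilator_in_carrier: "z \<in> annihilator A \<Longrightarrow> z \<in> carrier A"
  by (simp add: annihilator_def)

lemma dot_commutator_annihilator_mult:
  assumes a: "a \<in> carrier A" and b: "b \<in> carrier A"
    and z: "z \<in> annihilator A" and w: "w \<in> annihilator A"
  shows "dot_commutator A (z \<otimes> a) (w \<otimes> b) = dot_commutator A a b"
proof -
  have zw: "z \<in> carrier A" "w \<in> carrier A"
    using z w by (auto simp: annihilator_in_carrier)
  define d where "d = dot_commutator A a b"
  have d: "d \<in> carrier A" and e: "a \<otimes> b = d \<otimes> (b \<otimes> a)"
    using dot_commutator_unique[OF a b dot_commutator_closed[OF a b]] a b by (simp_all add: d_def)
  have c: "x \<otimes> z = z \<otimes> x" "x \<otimes> w = w \<otimes> x" if "x \<in> carrier A" for x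
    using z w that by (auto simp: annihilator_iff)
  \<comment> \<open>Stated for these three elements only, so that rewriting moves \<open>z\<close> and \<open>w\<close> past them without
    permuting \<open>z\<close> and \<open>w\<close> forever.\<close>
  have sw: "x \<otimes> (w \<otimes> y) = w \<otimes> (x \<otimes> y)" "x \<otimes> (z \<otimes> y) = z \<otimes> (x \<otimes> y)"
    if "x = a \<or> x = b \<or> x = d" "y \<in> carrier A" for x y
  proof -
    have "x \<in> carrier A"
      using that a b d by auto
    then show "x \<otimes> (w \<otimes> y) = w \<otimes> (x \<otimes> y)" "x \<otimes> (z \<otimes> y) = z \<otimes> (x \<otimes> y)"
      using that(2) zw by (simp_all add: c dot.m_assoc[symmetric])
  qed
  have wz: "w \<otimes> (z \<otimes> y) = z \<otimes> (w \<otimes> y)" if "y \<in> carrier A" for y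
    using that zw c(1)[of w] by (simp add: dot.m_assoc[symmetric])
  have "(z \<otimes> a) \<otimes> (w \<otimes> b) = z \<otimes> (w \<otimes> (a \<otimes> b))"
    using a b zw by (simp add: dot.m_assoc sw)
  also have "\<dots> = z \<otimes> (w \<otimes> (d \<otimes> (b \<otimes> a)))"
    by (simp only: e)
  also have "\<dots> = d \<otimes> ((w \<otimes> b) \<otimes> (z \<otimes> a))"
    using a b zw d by (simp add: dot.m_assoc sw wz)
  finally show ?thesis
    using a b zw d by (simp add: dot_commutator_unique d_def)
qed

lemma brace_star_annihilator_mult:
  assumes a: "a \<in> carrier A" and b: "b \<in> carrier A"
    and z: "z \<in> annihilator A" and w: "w \<in> annihilator A"
  shows "brace_star A (z \<otimes> a) (w \<otimes> b) = brace_star A a b"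
proof -
  have zw: "z \<in> carrier A" "w \<in> carrier A"
    using z w by (auto simp: annihilator_in_carrier)
  have c: "z \<circ>\<^bsub>A\<^esub> x = z \<otimes> x" "x \<circ>\<^bsub>A\<^esub> w = w \<otimes> x" "x \<otimes> w = w \<otimes> x" if "x \<in> carrier A" for x
    using z w that by (auto simp: annihilator_iff)
  have "(z \<otimes> a) \<circ>\<^bsub>A\<^esub> (w \<otimes> b) = (z \<circ>\<^bsub>A\<^esub> a) \<circ>\<^bsub>A\<^esub> (b \<circ>\<^bsub>A\<^esub> w)"
    using a b by (simp add: c)
  also have "\<dots> = z \<circ>\<^bsub>A\<^esub> ((a \<circ>\<^bsub>A\<^esub> b) \<circ>\<^bsub>A\<^esub> w)"
    using a b zw by (simp add: circ_assoc del: c)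
  also have "\<dots> = z \<otimes> ((a \<circ>\<^bsub>A\<^esub> b) \<otimes> w)"
    using a b zw c(1)[of "(a \<circ>\<^bsub>A\<^esub> b) \<circ>\<^bsub>A\<^esub> w"] by (simp add: c)
  also have "\<dots> = (z \<otimes> a) \<otimes> brace_star A a b \<otimes> (w \<otimes> b)"
  proof -
    have "x \<otimes> (w \<otimes> y) = w \<otimes> (x \<otimes> y)" if "x \<in> carrier A" "y \<in> carrier A" for x y
      using that zw by (simp add: c dot.m_assoc[symmetric])
    from this[of "a \<otimes> brace_star A a b" b] show ?thesis
      using a b zw by (simp add: circ_eq_mult_star dot.m_assoc c(3))
  qed
  finally show ?thesis
    using a b zw by (simp add: brace_star_unique)
qed

lemma Gamma2_generators_subset:
  "{brace_star A a b | a b. a \<in> carrier A \<and> b \<in> carrier A} \<union>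
   {dot_commutator A a b | a b. a \<in> carrier A \<and> b \<in> carrier A} \<subseteq> carrier A"
  by auto

lemma Gamma2_subgroup: "subgroup (Gamma2 A) A"
  unfolding Gamma2_def by (rule dot.generate_is_subgroup[OF Gamma2_generators_subset])

lemma brace_star_in_Gamma2:
  "\<lbrakk>a \<in> carrier A; b \<in> carrier A\<rbrakk> \<Longrightarrow> brace_star A a b \<in> Gamma2 A"
  unfolding Gamma2_def by (rule generate.incl) blast

lemma dot_commutator_in_Gamma2:
  "\<lbrakk>a \<in> carrier A; b \<in> carrier A\<rbrakk> \<Longrightarrow> dot_commutator A a b \<in> Gamma2 A"
  unfolding Gamma2_def by (rule generate.incl) blast

lemma Gamma2_in_carrier: "a \<in> Gamma2 A \<Longrightarrow> a \<in> carrier A"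
  using Gamma2_subgroup by (rule subgroup.mem_carrier)

lemma Gamma2_mult_closed: "\<lbrakk>a \<in> Gamma2 A; b \<in> Gamma2 A\<rbrakk> \<Longrightarrow> a \<otimes> b \<in> Gamma2 A"
  using Gamma2_subgroup by (rule subgroup.m_closed)

lemma Gamma2_circ_closed: "\<lbrakk>a \<in> Gamma2 A; b \<in> Gamma2 A\<rbrakk> \<Longrightarrow> a \<circ>\<^bsub>A\<^esub> b \<in> Gamma2 A"
  by (simp add: circ_eq_mult_star Gamma2_in_carrier Gamma2_mult_closed brace_star_in_Gamma2)

text \<open>
  In an abelian group viewed as a trivial brace all commutators and star products are trivial,
  and a brace homomorphism carries those of \<open>A\<close> to those of its target.
\<close>

lemma hom_to_comm_group_Gamma2:
  assumes C: "comm_group C" and f: "f \<in> hom A C" and f': "f \<in> hom (circ_group A) C"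
    and x: "x \<in> Gamma2 A"
  shows "f x = \<one>\<^bsub>C\<^esub>"
proof -
  interpret C: comm_group C by (rule C)
  interpret f: group_hom A C f
    using f by unfold_locales
  have circ: "f (a \<circ>\<^bsub>A\<^esub> b) = f a \<otimes>\<^bsub>C\<^esub> f b" if "a \<in> carrier A" "b \<in> carrier A" for a b
    using f' that by (simp add: hom_def)
  have star: "f (brace_star A a b) = \<one>\<^bsub>C\<^esub>" if ab: "a \<in> carrier A" "b \<in> carrier A" for a b
  proof -
    have "f a \<otimes>\<^bsub>C\<^esub> f b = f (a \<otimes> brace_star A a b \<otimes> b)"
      using circ[OF ab] circ_eq_mult_star[OF ab] by simp
    also have "\<dots> = f a \<otimes>\<^bsub>C\<^esub> f (brace_star A a b) \<otimes>\<^bsub>C\<^esub> f b"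
      using ab by simp
    finally show ?thesis
      using ab by simp
  qed
  have comm: "f (dot_commutator A a b) = \<one>\<^bsub>C\<^esub>" if ab: "a \<in> carrier A" "b \<in> carrier A" for a b
  proof -
    have "f a \<otimes>\<^bsub>C\<^esub> f b = f (dot_commutator A a b \<otimes> (b \<otimes> a))"
      using ab dot_commutator_unique by (metis dot_commutator_closed f.hom_mult)
    also have "\<dots> = f (dot_commutator A a b) \<otimes>\<^bsub>C\<^esub> (f a \<otimes>\<^bsub>C\<^esub> f b)"
      using ab by (simp add: C.m_comm)
    finally show ?thesis
      using ab by simp
  qed
  have "Gamma2 A \<subseteq> kernel A C f"
    unfolding Gamma2_def
    by (rule dot.generate_subgroup_incl[OF _ f.subgroup_kernel]) (auto simp: kernel_def star comm)
  with x show ?thesis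
    by (auto simp: kernel_def)
qed

end

section \<open>Isoclinism through surjective homomorphisms\<close>

locale brace_epi = E: skew_brace E + G: skew_brace G
  for E :: "'e skew_brace" and G :: "'g skew_brace" +
  fixes p :: "'e \<Rightarrow> 'g"
  assumes hom_dot: "p \<in> hom E G"
    and hom_circ: "p \<in> hom (circ_group E) (circ_group G)"
    and surj: "p ` carrier E = carrier G"
begin

sublocale dot_hom: group_hom E G p
  using hom_dot by unfold_locales

lemma p_circ: "\<lbrakk>x \<in> carrier E; y \<in> carrier E\<rbrakk> \<Longrightarrow> p (x \<circ>\<^bsub>E\<^esub> y) = p x \<circ>\<^bsub>G\<^esub> p y"
  using hom_circ by (simp add: hom_def)

lemma p_star:
  "\<lbrakk>x \<in> carrier E; y \<in> carrier E\<rbrakk> \<Longrightarrow> p (brace_star E x y) = brace_star G (p x) (p y)"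
  by (simp add: brace_star_def brace_lambda_def p_circ)

lemma p_commutator:
  "\<lbrakk>x \<in> carrier E; y \<in> carrier E\<rbrakk> \<Longrightarrow> p (dot_commutator E x y) = dot_commutator G (p x) (p y)"
  by (simp add: dot_commutator_def)

lemma Gamma2_image: "p ` Gamma2 E = Gamma2 G"
proof -
  have "p ` ({brace_star E a b | a b. a \<in> carrier E \<and> b \<in> carrier E} \<union>
      {dot_commutator E a b | a b. a \<in> carrier E \<and> b \<in> carrier E}) =
    {brace_star G a b | a b. a \<in> carrier G \<and> b \<in> carrier G} \<union>
      {dot_commutator G a b | a b. a \<in> carrier G \<and> b \<in> carrier G}" (is "p ` ?X = ?Y")
  proof -
    have img: "p ` {f a b | a b. a \<in> carrier E \<and> b \<in> carrier E} =
        {f' a b | a b. a \<in> carrier G \<and> b \<in> carrier G}"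
      if "\<And>a b. a \<in> carrier E \<Longrightarrow> b \<in> carrier E \<Longrightarrow> p (f a b) = f' (p a) (p b)" for f f'
    proof -
      have "p ` {f a b | a b. a \<in> carrier E \<and> b \<in> carrier E} =
          (\<lambda>(a, b). p (f a b)) ` (carrier E \<times> carrier E)"
        by auto
      also have "\<dots> = (\<lambda>(a, b). f' (p a) (p b)) ` (carrier E \<times> carrier E)"
        by (rule image_cong) (auto simp: that)
      also have "\<dots> = (\<lambda>(a, b). f' a b) ` (p ` carrier E \<times> p ` carrier E)"
        by force
      finally show ?thesis
        unfolding surj by auto
    qed
    show ?thesis
      using img[of "brace_star E" "brace_star G"] img[of "dot_commutator E" "dot_commutator G"]
      by (simp add: image_Un p_star p_commutator)
  qed
  then show ?thesis
    unfolding Gamma2_def using dot_hom.generate_img[OF E.Gamma2_generators_subset] by simp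
qed

end

text \<open>
  If \<open>f e = x y\<close>, choose any \<open>u\<close> above \<open>x\<close>; then \<open>u\<inverse> e\<close> lies above \<open>y\<close>. The statement is about
  arbitrary subsets, so that it serves the cosets of the annihilator in both groups of a brace.
\<close>

lemma surj_hom_vimage_set_mult:
  assumes M: "group M" and N: "group N" and f: "f \<in> hom M N" and sj: "f ` carrier M = carrier N"
    and X: "X \<subseteq> carrier N" and Y: "Y \<subseteq> carrier N"
  shows "f -` (X <#>\<^bsub>N\<^esub> Y) \<inter> carrier M = (f -` X \<inter> carrier M) <#>\<^bsub>M\<^esub> (f -` Y \<inter> carrier M)"
    (is "?L = ?R")
proof
  interpret M: group M by (rule M)
  interpret N: group N by (rule N)
  interpret f: group_hom M N f
    using f by unfold_locales
  show "?R \<subseteq> ?L"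
    by (auto simp: set_mult_def) blast
  show "?L \<subseteq> ?R"
  proof
    fix e assume "e \<in> ?L"
    then obtain x y where e: "e \<in> carrier M" and xy: "x \<in> X" "y \<in> Y" "f e = x \<otimes>\<^bsub>N\<^esub> y"
      by (auto simp: set_mult_def)
    then have c: "x \<in> carrier N" "y \<in> carrier N"
      using X Y by auto
    then obtain u where u: "u \<in> carrier M" "f u = x"
      by (auto simp flip: sj)
    have "f (inv\<^bsub>M\<^esub> u \<otimes>\<^bsub>M\<^esub> e) = y"
      using u e c xy(3) by (simp add: N.m_assoc[symmetric])
    moreover have "e = u \<otimes>\<^bsub>M\<^esub> (inv\<^bsub>M\<^esub> u \<otimes>\<^bsub>M\<^esub> e)"
      using u e by (simp add: M.m_assoc[symmetric])
    ultimately show "e \<in> ?R"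
      using u e xy unfolding set_mult_def by blast
  qed
qed

lemma hom_image_set_mult:
  assumes "f \<in> hom M N" "X \<subseteq> carrier M" "Y \<subseteq> carrier M"
  shows "f ` (X <#>\<^bsub>M\<^esub> Y) = f ` X <#>\<^bsub>N\<^esub> f ` Y"
proof -
  have "f (x \<otimes>\<^bsub>M\<^esub> y) = f x \<otimes>\<^bsub>N\<^esub> f y" if "x \<in> X" "y \<in> Y" for x y
    using assms that by (auto intro: hom_mult)
  then show ?thesis
    by (force simp: set_mult_def)
qed

text \<open>
  The elementary isoclinisms: such a \<open>p\<close> forgets nothing about commutators and star products,
  hence induces isomorphisms both on \<open>Gamma2\<close> and on the quotients by the annihilators.
\<close>

locale isoclinic_epi = brace_epi +
  assumes kernel_trivial: "\<lbrakk>x \<in> Gamma2 E; p x = \<one>\<^bsub>G\<^esub>\<rbrakk> \<Longrightarrow> x = \<one>\<^bsub>E\<^esub>"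
begin

lemma inj_on_Gamma2: "inj_on p (Gamma2 E)"
proof (rule inj_onI)
  fix x y assume xy: "x \<in> Gamma2 E" "y \<in> Gamma2 E" "p x = p y"
  then have c: "x \<in> carrier E" "y \<in> carrier E"
    by (auto simp: E.Gamma2_in_carrier)
  have "x \<otimes>\<^bsub>E\<^esub> inv\<^bsub>E\<^esub> y \<in> Gamma2 E"
    using xy E.Gamma2_subgroup by (simp add: E.Gamma2_mult_closed subgroup.m_inv_closed)
  then have "x \<otimes>\<^bsub>E\<^esub> inv\<^bsub>E\<^esub> y = \<one>\<^bsub>E\<^esub>"
    by (rule kernel_trivial) (use xy c in simp)
  then show "x = y"
    using c using E.dot.inv_solve_right[of "\<one>\<^bsub>E\<^esub>" x y] by simp
qed

text \<open>
  Being in the annihilator is a statement about elements of \<open>Gamma2\<close> being trivial, hence it is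
  reflected by \<open>p\<close>.
\<close>

lemma annihilator_iff_image:
  assumes x: "x \<in> carrier E"
  shows "p x \<in> annihilator G \<longleftrightarrow> x \<in> annihilator E"
proof -
  have one: "p y = \<one>\<^bsub>G\<^esub> \<longleftrightarrow> y = \<one>\<^bsub>E\<^esub>" if "y \<in> Gamma2 E" for y
    using kernel_trivial[OF that] dot_hom.hom_one by blast
  have "p x \<in> annihilator G \<longleftrightarrow> (\<forall>b \<in> p ` carrier E.
      brace_star G (p x) b = \<one>\<^bsub>G\<^esub> \<and> brace_star G b (p x) = \<one>\<^bsub>G\<^esub> \<and>
      dot_commutator G (p x) b = \<one>\<^bsub>G\<^esub>)"
    using x by (simp add: annihilator_def surj)
  also have "\<dots> \<longleftrightarrow> (\<forall>e \<in> carrier E. p (brace_star E x e) = \<one>\<^bsub>G\<^esub> \<and>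
      p (brace_star E e x) = \<one>\<^bsub>G\<^esub> \<and> p (dot_commutator E x e) = \<one>\<^bsub>G\<^esub>)"
    using x by (simp add: p_star p_commutator)
  also have "\<dots> \<longleftrightarrow> x \<in> annihilator E"
    using x by (simp add: annihilator_def one E.brace_star_in_Gamma2 E.dot_commutator_in_Gamma2)
  finally show ?thesis .
qed

lemma vimage_annihilator_coset:
  assumes x: "x \<in> carrier E"
  shows "p -` (annihilator G #>\<^bsub>G\<^esub> p x) \<inter> carrier E = annihilator E #>\<^bsub>E\<^esub> x" (is "?L = ?R")
proof
  show "?R \<subseteq> ?L"
    using x by (auto simp: r_coset_def E.annihilator_in_carrier annihilator_iff_image
      intro!: bexI[where x = "p _"])
  show "?L \<subseteq> ?R"
  proof
    fix y assume "y \<in> ?L"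
    then obtain z where y: "y \<in> carrier E" and z: "z \<in> annihilator G" "p y = z \<otimes>\<^bsub>G\<^esub> p x"
      by (auto simp: r_coset_def)
    have "p (y \<otimes>\<^bsub>E\<^esub> inv\<^bsub>E\<^esub> x) = z"
      using x y z by (simp add: G.annihilator_in_carrier G.dot.m_assoc)
    then have "y \<otimes>\<^bsub>E\<^esub> inv\<^bsub>E\<^esub> x \<in> annihilator E"
      using z x y annihilator_iff_image[of "y \<otimes>\<^bsub>E\<^esub> inv\<^bsub>E\<^esub> x"] by simp
    moreover have "y = (y \<otimes>\<^bsub>E\<^esub> inv\<^bsub>E\<^esub> x) \<otimes>\<^bsub>E\<^esub> x"
      using x y by (simp add: E.dot.m_assoc)
    ultimately show "y \<in> ?R"
      unfolding r_coset_def by blast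
  qed
qed

lemma image_annihilator_coset:
  assumes x: "x \<in> carrier E"
  shows "p ` (annihilator E #>\<^bsub>E\<^esub> x) = annihilator G #>\<^bsub>G\<^esub> p x"
proof -
  have "annihilator G #>\<^bsub>G\<^esub> p x \<subseteq> p ` carrier E"
    using x unfolding surj by (auto simp: r_coset_def G.annihilator_in_carrier)
  then show ?thesis
    unfolding vimage_annihilator_coset[OF x, symmetric] by auto
qed

lemma rcosets_annihilator:
  "rcosets\<^bsub>G\<^esub> (annihilator G) = (\<lambda>x. annihilator G #>\<^bsub>G\<^esub> p x) ` carrier E"
  by (auto simp: RCOSETS_def simp flip: surj)

lemma rcosets_annihilator_subset: "X \<in> rcosets\<^bsub>G\<^esub> (annihilator G) \<Longrightarrow> X \<subseteq> carrier G"
  by (auto simp: RCOSETS_def r_coset_def G.annihilator_in_carrier)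

end

text \<open>
  Both isomorphisms are transported through \<open>E\<close>: a coset of the annihilator of \<open>G\<close> is pulled
  back to \<open>E\<close> and pushed to \<open>H\<close>, and an element of \<open>Gamma2 G\<close> is lifted to its only preimage in
  \<open>Gamma2 E\<close> before it is sent to \<open>H\<close>. They are compatible because corresponding elements have,
  up to annihilating factors, a common lift to \<open>E\<close>.
\<close>

lemma isoclinic_span:
  assumes "isoclinic_epi E G p" and "isoclinic_epi E H q"
  shows "isoclinic G H"
proof -
  interpret p: isoclinic_epi E G p by fact
  interpret q: isoclinic_epi E H q by fact
  define \<xi> where "\<xi> X = q ` (p -` X \<inter> carrier E)" for X
  define \<theta> where "\<theta> g = q (inv_into (Gamma2 E) p g)" for g
  have \<xi>: "\<xi> (annihilator G #>\<^bsub>G\<^esub> p e) = annihilator H #>\<^bsub>H\<^esub> q e" if "e \<in> carrier E" for e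
    using that by (simp add: \<xi>_def p.vimage_annihilator_coset q.image_annihilator_coset)
  have \<theta>: "\<theta> (p e) = q e" if "e \<in> Gamma2 E" for e
    using that by (simp add: \<theta>_def inv_into_f_f[OF p.inj_on_Gamma2])

  \<comment> \<open>Multiplicativity holds for all subsets, so it need not be checked on representatives.\<close>
  have \<xi>_dot: "\<xi> (X <#>\<^bsub>G\<^esub> Y) = \<xi> X <#>\<^bsub>H\<^esub> \<xi> Y" if "X \<subseteq> carrier G" "Y \<subseteq> carrier G" for X Y
    unfolding \<xi>_def using that
    by (simp add: surj_hom_vimage_set_mult[OF p.E.dot.is_group p.G.dot.is_group p.hom_dot p.surj]
      hom_image_set_mult[OF q.hom_dot])
  have \<xi>_circ: "\<xi> (X <#>\<^bsub>circ_group G\<^esub> Y) = \<xi> X <#>\<^bsub>circ_group H\<^esub> \<xi> Y"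
    if "X \<subseteq> carrier G" "Y \<subseteq> carrier G" for X Y
    unfolding \<xi>_def using that
      surj_hom_vimage_set_mult[OF p.E.circle.is_group p.G.circle.is_group p.hom_circ, of X Y]
      hom_image_set_mult[OF q.hom_circ, of "p -` X \<inter> carrier E" "p -` Y \<inter> carrier E"]
    by (simp add: p.surj)
  have \<xi>_closed: "\<xi> X \<in> rcosets\<^bsub>H\<^esub> (annihilator H)" if "X \<in> rcosets\<^bsub>G\<^esub> (annihilator G)" for X
    using that by (auto simp: p.rcosets_annihilator q.rcosets_annihilator \<xi>)
  define \<zeta> where "\<zeta> Y = p ` (q -` Y \<inter> carrier E)" for Y
  have \<zeta>: "\<zeta> (annihilator H #>\<^bsub>H\<^esub> q e) = annihilator G #>\<^bsub>G\<^esub> p e" if "e \<in> carrier E" for e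
    using that by (simp add: \<zeta>_def q.vimage_annihilator_coset p.image_annihilator_coset)
  have "bij_betw \<xi> (rcosets\<^bsub>G\<^esub> (annihilator G)) (rcosets\<^bsub>H\<^esub> (annihilator H))"
    by (rule bij_betwI[where g = \<zeta>]) (auto simp: p.rcosets_annihilator q.rcosets_annihilator \<xi> \<zeta>)
  then have \<xi>_iso:
    "\<xi> \<in> brace_iso (quotient_brace G (annihilator G)) (quotient_brace H (annihilator H))"
    by (auto simp: brace_iso_def quotient_brace_def hom_def \<xi>_closed \<xi>_dot \<xi>_circ
      p.rcosets_annihilator_subset)

  have G2: "Gamma2 G = p ` Gamma2 E" and H2: "Gamma2 H = q ` Gamma2 E"
    by (simp_all add: p.Gamma2_image q.Gamma2_image)
  have "bij_betw \<theta> (Gamma2 G) (Gamma2 H)"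
    unfolding \<theta>_def bij_betw_def
  proof
    show "inj_on (\<lambda>g. q (inv_into (Gamma2 E) p g)) (Gamma2 G)"
      by (rule inj_onI)
        (auto simp: G2 inv_into_f_f[OF p.inj_on_Gamma2] dest: inj_onD[OF q.inj_on_Gamma2])
    show "(\<lambda>g. q (inv_into (Gamma2 E) p g)) ` Gamma2 G = Gamma2 H"
      by (simp add: G2 H2 image_image inv_into_f_f[OF p.inj_on_Gamma2])
  qed
  moreover have "\<theta> (x \<otimes>\<^bsub>G\<^esub> y) = \<theta> x \<otimes>\<^bsub>H\<^esub> \<theta> y" "\<theta> (x \<circ>\<^bsub>G\<^esub> y) = \<theta> x \<circ>\<^bsub>H\<^esub> \<theta> y"
    if "x \<in> Gamma2 G" "y \<in> Gamma2 G" for x y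
    using that \<theta>[OF p.E.Gamma2_mult_closed] \<theta>[OF p.E.Gamma2_circ_closed]
    by (auto simp: G2 \<theta> p.p_circ q.p_circ p.E.Gamma2_in_carrier)
  moreover have "\<theta> x \<in> Gamma2 H" if "x \<in> Gamma2 G" for x
    using that by (auto simp: G2 H2 \<theta>)
  ultimately have \<theta>_iso:
    "\<theta> \<in> brace_iso (G\<lparr>carrier := Gamma2 G\<rparr>) (H\<lparr>carrier := Gamma2 H\<rparr>)"
    by (auto simp: brace_iso_def hom_def)

  have coset_rep: "\<exists>e \<in> carrier E. \<exists>z \<in> annihilator H. a = p e \<and> b = z \<otimes>\<^bsub>H\<^esub> q e"
    if a: "a \<in> carrier G" and b: "b \<in> carrier H"
      and ab: "\<xi> (annihilator G #>\<^bsub>G\<^esub> a) = annihilator H #>\<^bsub>H\<^esub> b" for a b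
  proof -
    obtain e where e: "e \<in> carrier E" "a = p e"
      using a by (auto simp flip: p.surj)
    have "\<one>\<^bsub>H\<^esub> \<in> annihilator H"
      by (simp add: q.G.annihilator_iff)
    then have "b \<in> annihilator H #>\<^bsub>H\<^esub> b"
      using b by (force simp: r_coset_def)
    also have "\<dots> = annihilator H #>\<^bsub>H\<^esub> q e"
      using ab e by (simp add: \<xi>)
    finally show ?thesis
      using e by (auto simp: r_coset_def)
  qed
  have "\<theta> (dot_commutator G a1 a2) = dot_commutator H b1 b2 \<and>
      \<theta> (brace_star G a1 a2) = brace_star H b1 b2"
    if "a1 \<in> carrier G" "a2 \<in> carrier G" "b1 \<in> carrier H" "b2 \<in> carrier H"
      and \<xi>1: "\<xi> (annihilator G #>\<^bsub>G\<^esub> a1) = annihilator H #>\<^bsub>H\<^esub> b1"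
      and \<xi>2: "\<xi> (annihilator G #>\<^bsub>G\<^esub> a2) = annihilator H #>\<^bsub>H\<^esub> b2" for a1 a2 b1 b2
  proof -
    obtain e1 z1 where 1: "e1 \<in> carrier E" "z1 \<in> annihilator H" "a1 = p e1" "b1 = z1 \<otimes>\<^bsub>H\<^esub> q e1"
      using coset_rep \<open>a1 \<in> carrier G\<close> \<open>b1 \<in> carrier H\<close> \<xi>1 by blast
    obtain e2 z2 where 2: "e2 \<in> carrier E" "z2 \<in> annihilator H" "a2 = p e2" "b2 = z2 \<otimes>\<^bsub>H\<^esub> q e2"
      using coset_rep \<open>a2 \<in> carrier G\<close> \<open>b2 \<in> carrier H\<close> \<xi>2 by blast
    show ?thesis
      using 1 2 \<theta>[OF p.E.dot_commutator_in_Gamma2, of e1 e2] \<theta>[OF p.E.brace_star_in_Gamma2, of e1 e2]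
      by (simp add: q.G.dot_commutator_annihilator_mult q.G.brace_star_annihilator_mult
        p.p_star q.p_star p.p_commutator q.p_commutator)
  qed
  with \<xi>_iso \<theta>_iso show ?thesis
    unfolding isoclinic_def by blast
qed

section \<open>Characters separate the points of an abelian group\<close>

lemma comm_group_complex_units: "comm_group complex_units"
proof (rule comm_groupI)
  fix x assume "x \<in> carrier complex_units"
  then show "\<exists>y \<in> carrier complex_units. y \<otimes>\<^bsub>complex_units\<^esub> x = \<one>\<^bsub>complex_units\<^esub>"
    by (intro bexI[of _ "inverse x"]) (auto simp: complex_units_def)
qed (auto simp: complex_units_def)

lemma complex_units_simps [simp]:
  "carrier complex_units = UNIV - {0}" "x \<otimes>\<^bsub>complex_units\<^esub> y = x * y" "\<one>\<^bsub>complex_units\<^esub> = 1"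
  by (simp_all add: complex_units_def)

lemma complex_units_inv [simp]: "x \<noteq> 0 \<Longrightarrow> inv\<^bsub>complex_units\<^esub> x = inverse x"
  by (rule group.inv_equality)
    (simp_all add: comm_group.axioms(2)[OF comm_group_complex_units])

lemma complex_units_nat_pow: "x [^]\<^bsub>complex_units\<^esub> (n::nat) = x ^ n"
  by (induction n) (simp_all add: nat_pow_def mult.commute)

lemma character_nonzero: "\<lbrakk>\<chi> \<in> characters A; x \<in> carrier A\<rbrakk> \<Longrightarrow> \<chi> x \<noteq> 0"
  unfolding characters_def by (drule (1) hom_in_carrier) simp

lemma character_mult:
  "\<lbrakk>\<chi> \<in> characters A; x \<in> carrier A; y \<in> carrier A\<rbrakk> \<Longrightarrow> \<chi> (x \<otimes>\<^bsub>A\<^esub> y) = \<chi> x * \<chi> y"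
  by (simp add: characters_def hom_mult)

lemma character_one: "\<lbrakk>group A; \<chi> \<in> characters A\<rbrakk> \<Longrightarrow> \<chi> \<one>\<^bsub>A\<^esub> = 1"
  using hom_one[of \<chi> A complex_units] comm_group.axioms(2)[OF comm_group_complex_units]
  by (simp add: characters_def)

lemma int_pow_DirProd:
  assumes "group G" "group H" "x \<in> carrier G" "y \<in> carrier H"
  shows "(x, y) [^]\<^bsub>G \<times>\<times> H\<^esub> (k::int) = (x [^]\<^bsub>G\<^esub> k, y [^]\<^bsub>H\<^esub> k)"
proof -
  have GH: "group (G \<times>\<times> H)"
    using assms by (simp add: DirProd_group)
  have "fst \<in> hom (G \<times>\<times> H) G" "snd \<in> hom (G \<times>\<times> H) H"
    by (auto simp: hom_def DirProd_def)
  then have "fst ((x, y) [^]\<^bsub>G \<times>\<times> H\<^esub> k) = x [^]\<^bsub>G\<^esub> k" "snd ((x, y) [^]\<^bsub>G \<times>\<times> H\<^esub> k) = y [^]\<^bsub>H\<^esub> k"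
    using hom_int_pow[OF _ _ GH] assms by fastforce+
  then show ?thesis
    by (metis prod.collapse)
qed

text \<open>
  A homomorphism from a subgroup of \<open>A\<close> to \<open>C\<close>, encoded by its graph. Extension of homomorphisms
  is then inclusion of sets, as needed for Zorn's lemma, and a subgroup of the product is the
  graph of a function as soon as only the identity lies above the identity.
\<close>

definition partial_hom :: "('a, 'm) monoid_scheme \<Rightarrow> ('c, 'n) monoid_scheme \<Rightarrow> ('a \<times> 'c) set \<Rightarrow> bool" where
  "partial_hom A C R \<longleftrightarrow> subgroup R (A \<times>\<times> C) \<and> (\<forall>z. (\<one>\<^bsub>A\<^esub>, z) \<in> R \<longrightarrow> z = \<one>\<^bsub>C\<^esub>)"

locale abelian_pair = A: comm_group A + C: comm_group C
  for A :: "('a, 'm) monoid_scheme" and C :: "('c, 'n) monoid_scheme"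
begin

lemma DirProd_comm_group: "comm_group (A \<times>\<times> C)"
proof -
  interpret AC: group "A \<times>\<times> C"
    by (rule DirProd_group) unfold_locales
  show ?thesis
    by (rule AC.group_comm_groupI) (auto simp: A.m_comm C.m_comm)
qed

sublocale AC: comm_group "A \<times>\<times> C"
  by (rule DirProd_comm_group)

lemma partial_hom_carrier:
  assumes "partial_hom A C R" "(x, z) \<in> R"
  shows "x \<in> carrier A" "z \<in> carrier C"
  using assms by (auto simp: partial_hom_def dest: subgroup.mem_carrier)

lemma partial_hom_mult:
  assumes "partial_hom A C R" "(x, z) \<in> R" "(x', z') \<in> R"
  shows "(x \<otimes>\<^bsub>A\<^esub> x', z \<otimes>\<^bsub>C\<^esub> z') \<in> R"
  using assms subgroup.m_closed[of R "A \<times>\<times> C" "(x, z)" "(x', z')"] by (simp add: partial_hom_def)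

lemma partial_hom_inv:
  assumes "partial_hom A C R" "(x, z) \<in> R"
  shows "(inv\<^bsub>A\<^esub> x, inv\<^bsub>C\<^esub> z) \<in> R"
  using assms subgroup.m_inv_closed[of R "A \<times>\<times> C" "(x, z)"] partial_hom_carrier[OF assms]
  by (simp add: partial_hom_def)

lemma partial_hom_int_pow:
  assumes "partial_hom A C R" "(x, z) \<in> R"
  shows "(x [^]\<^bsub>A\<^esub> (k::int), z [^]\<^bsub>C\<^esub> k) \<in> R"
  using assms AC.subgroup_int_pow_closed[of R "(x, z)" k] partial_hom_carrier[OF assms]
  by (simp add: partial_hom_def int_pow_DirProd)

lemma partial_hom_unique:
  assumes R: "partial_hom A C R" and z: "(x, z) \<in> R" and z': "(x, z') \<in> R"
  shows "z = z'"
proof -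
  have "(x \<otimes>\<^bsub>A\<^esub> inv\<^bsub>A\<^esub> x, z \<otimes>\<^bsub>C\<^esub> inv\<^bsub>C\<^esub> z') \<in> R"
    using partial_hom_mult[OF R z partial_hom_inv[OF R z']] .
  then have "z \<otimes>\<^bsub>C\<^esub> inv\<^bsub>C\<^esub> z' = \<one>\<^bsub>C\<^esub>"
    using R partial_hom_carrier[OF R z] by (simp add: partial_hom_def)
  then show ?thesis
    using partial_hom_carrier[OF R z] partial_hom_carrier[OF R z'] C.inv_solve_right[of "\<one>\<^bsub>C\<^esub>" z z']
    by simp
qed

text \<open>
  Adjoining one element \<open>x\<close> with value \<open>w\<close>: the only obstruction comes from the powers of \<open>x\<close>
  that already lie in the domain.
\<close>

lemma partial_hom_extend:
  assumes R: "partial_hom A C R" and x: "x \<in> carrier A" and w: "w \<in> carrier C"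
    and compat: "\<And>(k::int) z. (x [^]\<^bsub>A\<^esub> k, z) \<in> R \<Longrightarrow> z = w [^]\<^bsub>C\<^esub> k"
  obtains R' where "partial_hom A C R'" "R \<subseteq> R'" "(x, w) \<in> R'"
proof
  let ?g = "generate (A \<times>\<times> C) {(x, w)}"
  have sub: "subgroup R (A \<times>\<times> C)"
    using R by (simp add: partial_hom_def)
  have g: "?g = {(x [^]\<^bsub>A\<^esub> k, w [^]\<^bsub>C\<^esub> k) | k::int. True}"
    using x w by (simp add: AC.generate_pow int_pow_DirProd)
  have g_sub: "subgroup ?g (A \<times>\<times> C)"
    using x w by (intro AC.generate_is_subgroup) simp
  show "R \<subseteq> R <#>\<^bsub>A \<times>\<times> C\<^esub> ?g"
  proof
    fix r assume r: "r \<in> R"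
    then have "r = r \<otimes>\<^bsub>A \<times>\<times> C\<^esub> \<one>\<^bsub>A \<times>\<times> C\<^esub>"
      using AC.r_one subgroup.mem_carrier[OF sub r] by metis
    with r subgroup.one_closed[OF g_sub] show "r \<in> R <#>\<^bsub>A \<times>\<times> C\<^esub> ?g"
      unfolding set_mult_def by blast
  qed
  show "(x, w) \<in> R <#>\<^bsub>A \<times>\<times> C\<^esub> ?g"
  proof -
    have "(x, w) = \<one>\<^bsub>A \<times>\<times> C\<^esub> \<otimes>\<^bsub>A \<times>\<times> C\<^esub> (x, w)"
      using x w by simp
    moreover have "(x, w) \<in> ?g"
      by (rule generate.incl) simp
    ultimately show ?thesis
      using subgroup.one_closed[OF sub] unfolding set_mult_def by blast
  qed
  have "z = \<one>\<^bsub>C\<^esub>" if z: "(\<one>\<^bsub>A\<^esub>, z) \<in> R <#>\<^bsub>A \<times>\<times> C\<^esub> ?g" for z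
  proof -
    obtain y v and k :: int where yv: "(y, v) \<in> R"
      and 1: "y \<otimes>\<^bsub>A\<^esub> x [^]\<^bsub>A\<^esub> k = \<one>\<^bsub>A\<^esub>" and zv: "z = v \<otimes>\<^bsub>C\<^esub> w [^]\<^bsub>C\<^esub> k"
      using z unfolding g by (auto simp: set_mult_def)
    note c = partial_hom_carrier[OF R yv]
    have "x [^]\<^bsub>A\<^esub> k = inv\<^bsub>A\<^esub> y"
      using 1 c x A.inv_solve_left[of "x [^]\<^bsub>A\<^esub> k" y "\<one>\<^bsub>A\<^esub>"] by simp
    then have "inv\<^bsub>C\<^esub> v = w [^]\<^bsub>C\<^esub> k"
      using compat[of k "inv\<^bsub>C\<^esub> v"] partial_hom_inv[OF R yv] by simp
    then show ?thesis
      using c zv by (metis C.r_inv)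
  qed
  then show "partial_hom A C (R <#>\<^bsub>A \<times>\<times> C\<^esub> ?g)"
    unfolding partial_hom_def by (simp add: AC.mult_subgroups[OF sub g_sub])
qed

lemma partial_hom_Union:
  assumes ne: "\<C> \<noteq> {}" and ph: "\<And>R. R \<in> \<C> \<Longrightarrow> partial_hom A C R"
    and lin: "\<And>R S. R \<in> \<C> \<Longrightarrow> S \<in> \<C> \<Longrightarrow> R \<subseteq> S \<or> S \<subseteq> R"
  shows "partial_hom A C (\<Union>\<C>)"
proof -
  have sub: "subgroup R (A \<times>\<times> C)" if "R \<in> \<C>" for R
    using ph[OF that] by (simp add: partial_hom_def)
  have "subgroup (\<Union>\<C>) (A \<times>\<times> C)"
  proof (rule AC.subgroupI)
    show "\<Union>\<C> \<subseteq> carrier (A \<times>\<times> C)"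
      using subgroup.subset[OF sub] by blast
    show "\<Union>\<C> \<noteq> {}"
      using ne subgroup.one_closed[OF sub] by blast
    show "inv\<^bsub>A \<times>\<times> C\<^esub> a \<in> \<Union>\<C>" if "a \<in> \<Union>\<C>" for a
      using that subgroup.m_inv_closed[OF sub] by blast
    show "a \<otimes>\<^bsub>A \<times>\<times> C\<^esub> b \<in> \<Union>\<C>" if ab: "a \<in> \<Union>\<C>" "b \<in> \<Union>\<C>" for a b
    proof -
      obtain R where "R \<in> \<C>" "a \<in> R" "b \<in> R"
        using ab lin by blast
      then show ?thesis
        using subgroup.m_closed[OF sub] by blast
    qed
  qed
  then show ?thesis
    using ph by (auto simp: partial_hom_def)
qed

end

text \<open>
  Here divisibility of the nonzero complex numbers enters. If \<open>x\<^sup>n\<close> is the first positive power of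
  \<open>x\<close> in the domain, with value \<open>z0\<close>, then any \<open>n\<close>-th root of \<open>z0\<close> is a compatible value at \<open>x\<close>.
  If \<open>x\<close> is not in the domain then \<open>n \<ge> 2\<close>, so one of the \<open>n\<close> roots differs from \<open>1\<close>; this freedom is what
  makes characters separate points.
\<close>

lemma partial_character_compatible_value:
  assumes A: "comm_group A" and R: "partial_hom A complex_units R"
    and x: "x \<in> carrier A" and x_new: "\<And>z. (x, z) \<notin> R"
  obtains w where "w \<in> carrier complex_units" "w \<noteq> 1"
    "\<And>(k::int) z. (x [^]\<^bsub>A\<^esub> k, z) \<in> R \<Longrightarrow> z = w [^]\<^bsub>complex_units\<^esub> k"
proof -
  interpret abelian_pair A complex_units
    using A comm_group_complex_units by (simp add: abelian_pair_def)
  have zero: "z = 1" if "(x [^]\<^bsub>A\<^esub> (0::int), z) \<in> R" for z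
    using that R by (simp add: partial_hom_def)
  show thesis
  proof (cases "\<exists>n::nat. n > 0 \<and> (\<exists>z. (x [^]\<^bsub>A\<^esub> int n, z) \<in> R)")
    case False
    \<comment> \<open>No nontrivial power of \<open>x\<close> has a prescribed value, so that any \<open>w \<noteq> 1\<close> will do.\<close>
    have "z = 2 [^]\<^bsub>complex_units\<^esub> k" if k: "(x [^]\<^bsub>A\<^esub> k, z) \<in> R" for k :: int and z
    proof -
      have "(x [^]\<^bsub>A\<^esub> (- k), inv\<^bsub>complex_units\<^esub> z) \<in> R"
        using partial_hom_inv[OF R k] x by (simp add: A.int_pow_neg)
      with False k have "\<not> 0 < k" "\<not> 0 < - k"
        by (metis zero_less_imp_eq_int)+
      then have "k = 0"
        by simp
      with k zero show ?thesis
        by simp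
    qed
    then show thesis
      by (intro that[of 2]) auto
  next
    case True
    define n where "n = (LEAST n::nat. n > 0 \<and> (\<exists>z. (x [^]\<^bsub>A\<^esub> int n, z) \<in> R))"
    have n: "n > 0" "\<exists>z. (x [^]\<^bsub>A\<^esub> int n, z) \<in> R"
      using LeastI_ex[OF True] by (simp_all add: n_def)
    have least: "r = 0" if "(x [^]\<^bsub>A\<^esub> int r, z) \<in> R" "r < n" for r z
      using not_less_Least[of r "\<lambda>n. n > 0 \<and> (\<exists>z. (x [^]\<^bsub>A\<^esub> int n, z) \<in> R)"] that
      by (auto simp: n_def)
    obtain z0 where z0: "(x [^]\<^bsub>A\<^esub> int n, z0) \<in> R"
      using n by blast
    then have "z0 \<noteq> 0"
      using partial_hom_carrier[OF R] by fastforce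
    have "n \<noteq> 1"
      using z0 x_new x by auto
    with n have "n \<ge> 2"
      by simp
    have "\<not> {w::complex. w ^ n = z0} \<subseteq> {1}"
    proof
      assume "{w::complex. w ^ n = z0} \<subseteq> {1}"
      then have "card {w::complex. w ^ n = z0} \<le> 1"
        using card_mono[of "{1::complex}"] by simp
      with \<open>n \<ge> 2\<close> card_nth_roots[OF \<open>z0 \<noteq> 0\<close> n(1)] show False
        by simp
    qed
    then obtain w where w: "w ^ n = z0" "w \<noteq> 1"
      by auto
    then have "w \<noteq> 0"
      using \<open>z0 \<noteq> 0\<close> n by auto
    have "z = w [^]\<^bsub>complex_units\<^esub> k" if k: "(x [^]\<^bsub>A\<^esub> k, z) \<in> R" for k :: int and z
    proof -
      define q where "q = k div int n"
      have kq: "k = int n * q + k mod int n"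
        by (simp add: q_def)
      have q: "(x [^]\<^bsub>A\<^esub> (int n * q), w [^]\<^bsub>complex_units\<^esub> (int n * q)) \<in> R"
      proof -
        have "w [^]\<^bsub>complex_units\<^esub> int n = z0"
          using w by (simp add: int_pow_int complex_units_nat_pow)
        then show ?thesis
          using partial_hom_int_pow[OF R z0, of q] x \<open>w \<noteq> 0\<close> C.int_pow_pow[of w "int n" q]
            A.int_pow_pow[OF x, of "int n" q] by simp
      qed
      have "(x [^]\<^bsub>A\<^esub> k \<otimes>\<^bsub>A\<^esub> inv\<^bsub>A\<^esub> (x [^]\<^bsub>A\<^esub> (int n * q)),
          z \<otimes>\<^bsub>complex_units\<^esub> inv\<^bsub>complex_units\<^esub> (w [^]\<^bsub>complex_units\<^esub> (int n * q))) \<in> R"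
        by (rule partial_hom_mult[OF R k partial_hom_inv[OF R q]])
      moreover have "x [^]\<^bsub>A\<^esub> k \<otimes>\<^bsub>A\<^esub> inv\<^bsub>A\<^esub> (x [^]\<^bsub>A\<^esub> (int n * q)) = x [^]\<^bsub>A\<^esub> int (nat (k mod int n))"
        using x n kq by (simp add: A.int_pow_diff[symmetric] minus_mult_div_eq_mod q_def)
      moreover have "nat (k mod int n) < n"
        using n by (simp add: nat_less_iff)
      ultimately have "nat (k mod int n) = 0"
        using least by metis
      then have "k mod int n = 0"
        using n pos_mod_sign[of "int n" k] by linarith
      with kq have "k = int n * q"
        by simp
      with q k show ?thesis
        using partial_hom_unique[OF R] by simp
    qed
    with w \<open>w \<noteq> 0\<close> show thesis
      by (intro that[of w]) auto
  qed
qed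

text \<open>
  For \<open>a \<noteq> 1\<close> there is a character of the subgroup generated by \<open>a\<close> that is not \<open>1\<close> at \<open>a\<close>; a
  maximal extension of it is defined everywhere, since otherwise one more element could be
  adjoined.
\<close>

theorem characters_separate_points:
  assumes A: "comm_group A" and a: "a \<in> carrier A" and trivial: "\<And>\<chi>. \<chi> \<in> characters A \<Longrightarrow> \<chi> a = 1"
  shows "a = \<one>\<^bsub>A\<^esub>"
proof (rule ccontr)
  assume a1: "a \<noteq> \<one>\<^bsub>A\<^esub>"
  interpret abelian_pair A complex_units
    using A comm_group_complex_units by (simp add: abelian_pair_def)
  have triv: "partial_hom A complex_units {(\<one>\<^bsub>A\<^esub>, 1)}"
    using AC.triv_subgroup by (simp add: partial_hom_def)
  obtain w where w: "w \<in> carrier complex_units" "w \<noteq> 1"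
    "\<And>(k::int) z. (a [^]\<^bsub>A\<^esub> k, z) \<in> {(\<one>\<^bsub>A\<^esub>, 1)} \<Longrightarrow> z = w [^]\<^bsub>complex_units\<^esub> k"
    using partial_character_compatible_value[OF A triv a] a1 by auto
  obtain R0 where R0: "partial_hom A complex_units R0" "(a, w) \<in> R0"
    using partial_hom_extend[OF triv a w(1,3)] by blast
  define \<S> where "\<S> = {R. partial_hom A complex_units R \<and> R0 \<subseteq> R}"
  have "\<exists>M\<in>\<S>. \<forall>X\<in>\<S>. M \<subseteq> X \<longrightarrow> X = M"
  proof (rule subset_Zorn_nonempty)
    show "\<S> \<noteq> {}"
      using R0 by (auto simp: \<S>_def)
    show "\<Union>\<C> \<in> \<S>" if "\<C> \<noteq> {}" "subset.chain \<S> \<C>" for \<C>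
      using that partial_hom_Union[of \<C>] unfolding \<S>_def subset_chain_def by blast
  qed
  then obtain M where M: "partial_hom A complex_units M" "R0 \<subseteq> M"
    and max: "\<And>X. partial_hom A complex_units X \<Longrightarrow> M \<subseteq> X \<Longrightarrow> X = M"
    unfolding \<S>_def by (metis (no_types, lifting) mem_Collect_eq subset_trans)
  have total: "\<exists>z. (x, z) \<in> M" if x: "x \<in> carrier A" for x
  proof (rule ccontr)
    assume "\<nexists>z. (x, z) \<in> M"
    then obtain v where "v \<in> carrier complex_units"
      "\<And>(k::int) z. (x [^]\<^bsub>A\<^esub> k, z) \<in> M \<Longrightarrow> z = v [^]\<^bsub>complex_units\<^esub> k"
      using partial_character_compatible_value[OF A M(1) x] by blast
    then obtain M' where "partial_hom A complex_units M'" "M \<subseteq> M'" "(x, v) \<in> M'"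
      using partial_hom_extend[OF M(1) x] by metis
    with max \<open>\<nexists>z. (x, z) \<in> M\<close> show False
      by blast
  qed
  define \<chi> where "\<chi> x = (THE z. (x, z) \<in> M)" for x
  have \<chi>: "\<chi> x = z" if "(x, z) \<in> M" for x z
    unfolding \<chi>_def using that partial_hom_unique[OF M(1)] by blast
  have \<chi>_graph: "(x, \<chi> x) \<in> M" if "x \<in> carrier A" for x
    using total[OF that] \<chi> by auto
  have "\<chi> \<in> characters A"
    unfolding characters_def
  proof (rule homI)
    show "\<chi> x \<in> carrier complex_units" if "x \<in> carrier A" for x
      using partial_hom_carrier(2)[OF M(1) \<chi>_graph[OF that]] .
    show "\<chi> (x \<otimes>\<^bsub>A\<^esub> y) = \<chi> x \<otimes>\<^bsub>complex_units\<^esub> \<chi> y" if "x \<in> carrier A" "y \<in> carrier A" for x y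
      using \<chi>[OF partial_hom_mult[OF M(1) \<chi>_graph \<chi>_graph]] that by simp
  qed
  with trivial \<chi>[of a w] R0 M w show False
    by auto
qed

section \<open>Annihilator extensions\<close>

lemma (in comm_group) four_term_cocycle:
  assumes "a \<in> carrier G" "b \<in> carrier G" "c \<in> carrier G" "d \<in> carrier G"
    and "a \<otimes> inv b \<otimes> c \<otimes> inv d = \<one>"
  shows "a \<otimes> c = d \<otimes> b"
proof -
  have "d = a \<otimes> inv b \<otimes> c"
    using assms inv_solve_right[of \<one> "a \<otimes> inv b \<otimes> c" d] by simp
  then have "d = (a \<otimes> c) \<otimes> inv b"
    using assms(1-4) by (simp add: m_ac)
  then show ?thesis
    using assms(1-4) inv_solve_right[of d "a \<otimes> c" b] by simp
qed

lemma (in comm_group) six_term_cocycle: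
  assumes "a \<in> carrier G" "b \<in> carrier G" "c \<in> carrier G"
    and "d \<in> carrier G" "e \<in> carrier G" "f \<in> carrier G"
    and "a \<otimes> inv b \<otimes> c = d \<otimes> inv e \<otimes> f"
  shows "a \<otimes> c \<otimes> e = d \<otimes> f \<otimes> b"
proof -
  have "a \<otimes> c = (a \<otimes> inv b \<otimes> c) \<otimes> b"
    using assms(1-3) inv_solve_right[of "a \<otimes> inv b \<otimes> c" "a \<otimes> c" b] by (simp add: m_ac)
  also have "\<dots> = (d \<otimes> f \<otimes> b) \<otimes> inv e"
    unfolding assms(7) using assms(1-6) by (simp add: m_ac)
  finally show ?thesis
    using assms(1-6) inv_solve_right[of "a \<otimes> c" "d \<otimes> f \<otimes> b" e] by simp
qed

lemma (in comm_group) conjugate_eq: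
  "\<lbrakk>a \<in> carrier G; b \<in> carrier G\<rbrakk> \<Longrightarrow> a \<otimes> (b \<otimes> inv a) = b"
  by (simp add: m_comm[of b] m_assoc[symmetric])

text \<open>
  The scheme \<open>M\<close> is only specified by its operation, because the lemma is applied to both groups
  of a brace extension, which are different kinds of records.
\<close>

lemma central_extension_group:
  fixes M :: "('a \<times> 'k, 'z) monoid_scheme"
  assumes A: "comm_group A" and Q: "group Q"
    and closed: "\<And>x y. \<lbrakk>x \<in> carrier Q; y \<in> carrier Q\<rbrakk> \<Longrightarrow> f (x, y) \<in> carrier A"
    and norm: "\<And>x. x \<in> carrier Q \<Longrightarrow> f (\<one>\<^bsub>Q\<^esub>, x) = \<one>\<^bsub>A\<^esub>"
    and cocycle: "\<And>x y z. \<lbrakk>x \<in> carrier Q; y \<in> carrier Q; z \<in> carrier Q\<rbrakk> \<Longrightarrow>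
      f (y, z) \<otimes>\<^bsub>A\<^esub> f (x, y \<otimes>\<^bsub>Q\<^esub> z) = f (x, y) \<otimes>\<^bsub>A\<^esub> f (x \<otimes>\<^bsub>Q\<^esub> y, z)"
    and carrier: "carrier M = carrier A \<times> carrier Q"
    and mult: "\<And>a x b y. (a, x) \<otimes>\<^bsub>M\<^esub> (b, y) = (a \<otimes>\<^bsub>A\<^esub> b \<otimes>\<^bsub>A\<^esub> f (x, y), x \<otimes>\<^bsub>Q\<^esub> y)"
    and one: "\<one>\<^bsub>M\<^esub> = (\<one>\<^bsub>A\<^esub>, \<one>\<^bsub>Q\<^esub>)"
  shows "group M"
proof -
  interpret A: comm_group A by (rule A)
  interpret Q: group Q by (rule Q)
  show ?thesis
  proof (rule groupI)
    show "u \<otimes>\<^bsub>M\<^esub> v \<in> carrier M" if "u \<in> carrier M" "v \<in> carrier M" for u v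
      using that by (auto simp: carrier mult closed)
    show "\<one>\<^bsub>M\<^esub> \<in> carrier M"
      by (simp add: one carrier)
    show "\<one>\<^bsub>M\<^esub> \<otimes>\<^bsub>M\<^esub> u = u" if "u \<in> carrier M" for u
      using that by (auto simp: carrier mult one norm)
    show "u \<otimes>\<^bsub>M\<^esub> v \<otimes>\<^bsub>M\<^esub> w = u \<otimes>\<^bsub>M\<^esub> (v \<otimes>\<^bsub>M\<^esub> w)"
      if uvw: "u \<in> carrier M" "v \<in> carrier M" "w \<in> carrier M" for u v w
    proof -
      obtain a x b y c z where eq: "u = (a, x)" "v = (b, y)" "w = (c, z)"
        by (cases u, cases v, cases w) blast
      have c: "a \<in> carrier A" "b \<in> carrier A" "c \<in> carrier A"
        "x \<in> carrier Q" "y \<in> carrier Q" "z \<in> carrier Q"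
        using uvw by (auto simp: eq carrier)
      have "a \<otimes>\<^bsub>A\<^esub> b \<otimes>\<^bsub>A\<^esub> f (x, y) \<otimes>\<^bsub>A\<^esub> c \<otimes>\<^bsub>A\<^esub> f (x \<otimes>\<^bsub>Q\<^esub> y, z)
          = a \<otimes>\<^bsub>A\<^esub> b \<otimes>\<^bsub>A\<^esub> c \<otimes>\<^bsub>A\<^esub> (f (x, y) \<otimes>\<^bsub>A\<^esub> f (x \<otimes>\<^bsub>Q\<^esub> y, z))"
        using c by (simp add: closed A.m_ac)
      also have "\<dots> = a \<otimes>\<^bsub>A\<^esub> b \<otimes>\<^bsub>A\<^esub> c \<otimes>\<^bsub>A\<^esub> (f (y, z) \<otimes>\<^bsub>A\<^esub> f (x, y \<otimes>\<^bsub>Q\<^esub> z))"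
        using cocycle c by simp
      also have "\<dots> = a \<otimes>\<^bsub>A\<^esub> (b \<otimes>\<^bsub>A\<^esub> c \<otimes>\<^bsub>A\<^esub> f (y, z)) \<otimes>\<^bsub>A\<^esub> f (x, y \<otimes>\<^bsub>Q\<^esub> z)"
        using c by (simp add: closed A.m_ac)
      finally show ?thesis
        using c by (simp add: eq mult Q.m_assoc)
    qed
    show "\<exists>v \<in> carrier M. v \<otimes>\<^bsub>M\<^esub> u = \<one>\<^bsub>M\<^esub>" if u: "u \<in> carrier M" for u
    proof -
      obtain a x where eq: "u = (a, x)"
        by (cases u) blast
      let ?b = "inv\<^bsub>A\<^esub> (a \<otimes>\<^bsub>A\<^esub> f (inv\<^bsub>Q\<^esub> x, x))"
      have c: "a \<in> carrier A" "x \<in> carrier Q"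
        using u by (auto simp: eq carrier)
      then have "(?b, inv\<^bsub>Q\<^esub> x) \<otimes>\<^bsub>M\<^esub> u = \<one>\<^bsub>M\<^esub>"
        by (simp add: eq mult one closed A.m_assoc)
      with c show ?thesis
        by (intro bexI[of _ "(?b, inv\<^bsub>Q\<^esub> x)"]) (auto simp: carrier closed)
    qed
  qed
qed

locale brace_cocycle = A: comm_group A + K: skew_brace K
  for A :: "('a, 'n) monoid_scheme" and K :: "('k, 'm) skew_brace_scheme" +
  fixes \<alpha> \<mu> :: "'k \<times> 'k \<Rightarrow> 'a"
  assumes cocycle: "(\<alpha>, \<mu>) \<in> cocycles2 K A"
begin

abbreviation ext :: "('a \<times> 'k) skew_brace" where
  "ext \<equiv> annihilator_extension A K (\<alpha>, \<mu>)"

lemma cocycle_closed [simp, intro]: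
  assumes "x \<in> carrier K" "y \<in> carrier K"
  shows "\<alpha> (x, y) \<in> carrier A" "\<mu> (x, y) \<in> carrier A"
  using cocycle assms unfolding cocycles2_def by blast+

lemma cocycle_one [simp]:
  assumes "x \<in> carrier K"
  shows "\<alpha> (\<one>\<^bsub>K\<^esub>, x) = \<one>\<^bsub>A\<^esub>" "\<alpha> (x, \<one>\<^bsub>K\<^esub>) = \<one>\<^bsub>A\<^esub>"
    "\<mu> (\<one>\<^bsub>K\<^esub>, x) = \<one>\<^bsub>A\<^esub>" "\<mu> (x, \<one>\<^bsub>K\<^esub>) = \<one>\<^bsub>A\<^esub>"
  using cocycle assms unfolding cocycles2_def by blast+

lemma cocycle_dot:
  assumes "x \<in> carrier K" "y \<in> carrier K" "z \<in> carrier K"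
  shows "\<alpha> (y, z) \<otimes>\<^bsub>A\<^esub> \<alpha> (x, y \<otimes>\<^bsub>K\<^esub> z) = \<alpha> (x, y) \<otimes>\<^bsub>A\<^esub> \<alpha> (x \<otimes>\<^bsub>K\<^esub> y, z)"
  by (rule A.four_term_cocycle) (use cocycle assms in \<open>auto simp: cocycles2_def\<close>)

lemma cocycle_circ:
  assumes "x \<in> carrier K" "y \<in> carrier K" "z \<in> carrier K"
  shows "\<mu> (y, z) \<otimes>\<^bsub>A\<^esub> \<mu> (x, y \<circ>\<^bsub>K\<^esub> z) = \<mu> (x, y) \<otimes>\<^bsub>A\<^esub> \<mu> (x \<circ>\<^bsub>K\<^esub> y, z)"
  by (rule A.four_term_cocycle) (use cocycle assms in \<open>auto simp: cocycles2_def\<close>)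

lemma cocycle_mixed:
  assumes "x \<in> carrier K" "y \<in> carrier K" "z \<in> carrier K"
  shows "\<alpha> (y, z) \<otimes>\<^bsub>A\<^esub> \<alpha> (x, brace_lambda K x z) \<otimes>\<^bsub>A\<^esub> \<mu> (x, y \<otimes>\<^bsub>K\<^esub> z)
    = \<mu> (x, y) \<otimes>\<^bsub>A\<^esub> \<mu> (x, z) \<otimes>\<^bsub>A\<^esub> \<alpha> (x \<circ>\<^bsub>K\<^esub> y, brace_lambda K x z)"
  by (rule A.six_term_cocycle) (use cocycle assms in \<open>auto simp: cocycles2_def\<close>)

lemma ext_simps [simp]:
  "carrier ext = carrier A \<times> carrier K"
  "\<one>\<^bsub>ext\<^esub> = (\<one>\<^bsub>A\<^esub>, \<one>\<^bsub>K\<^esub>)"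
  "(a, x) \<otimes>\<^bsub>ext\<^esub> (b, y) = (a \<otimes>\<^bsub>A\<^esub> b \<otimes>\<^bsub>A\<^esub> \<alpha> (x, y), x \<otimes>\<^bsub>K\<^esub> y)"
  "(a, x) \<circ>\<^bsub>ext\<^esub> (b, y) = (a \<otimes>\<^bsub>A\<^esub> b \<otimes>\<^bsub>A\<^esub> \<mu> (x, y), x \<circ>\<^bsub>K\<^esub> y)"
  by (simp_all add: annihilator_extension_def)

lemma group_ext: "group ext"
  by (rule central_extension_group[where A = A and Q = K and f = \<alpha>])
    (use A.comm_group_axioms K.dot.is_group cocycle_dot in \<open>auto\<close>)

lemma group_circ_ext: "group (circ_group ext)"
  by (rule central_extension_group[where A = A and Q = "circ_group K" and f = \<mu>])
    (use A.comm_group_axioms K.circle.is_group cocycle_circ in \<open>auto\<close>)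

text \<open>
  With \<open>t = u\<inverse> (u \<circ> w)\<close>, whose \<open>K\<close>-component is \<open>\<lambda>\<^sub>x z\<close>, the brace identity becomes
  \<open>u \<circ> (v w) = (u \<circ> v) t\<close>; its \<open>A\<close>-component is the condition that links \<open>\<alpha>\<close> and \<open>\<mu>\<close>.
\<close>

lemma skew_brace_ext: "skew_brace ext"
proof (rule skew_brace.intro[OF group_ext group_circ_ext])
  interpret dot: group ext by (rule group_ext)
  show "skew_brace_axioms ext"
  proof
    fix u v w assume uvw: "u \<in> carrier ext" "v \<in> carrier ext" "w \<in> carrier ext"
    obtain a x b y c z where eq: "u = (a, x)" "v = (b, y)" "w = (c, z)"
      by (cases u, cases v, cases w) blast
    have c: "a \<in> carrier A" "b \<in> carrier A" "c \<in> carrier A"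
      "x \<in> carrier K" "y \<in> carrier K" "z \<in> carrier K"
      using uvw by (auto simp: eq)
    let ?l = "brace_lambda K x z"
    have l: "?l \<in> carrier K" "x \<otimes>\<^bsub>K\<^esub> ?l = x \<circ>\<^bsub>K\<^esub> z"
      using c by (simp_all add: K.mult_brace_lambda)
    let ?t = "(c \<otimes>\<^bsub>A\<^esub> \<mu> (x, z) \<otimes>\<^bsub>A\<^esub> inv\<^bsub>A\<^esub> \<alpha> (x, ?l), ?l)"
    have t: "?t \<in> carrier ext" "u \<circ>\<^bsub>ext\<^esub> w \<in> carrier ext"
      using c l by (simp_all add: eq)
    have "u \<otimes>\<^bsub>ext\<^esub> ?t = u \<circ>\<^bsub>ext\<^esub> w"
      using c l by (simp add: eq A.m_assoc)
    then have inv_u: "inv\<^bsub>ext\<^esub> u \<otimes>\<^bsub>ext\<^esub> (u \<circ>\<^bsub>ext\<^esub> w) = ?t"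
      using dot.inv_solve_left'[of "?t" u "u \<circ>\<^bsub>ext\<^esub> w"] uvw(1) t by simp
    have "u \<circ>\<^bsub>ext\<^esub> v \<otimes>\<^bsub>ext\<^esub> inv\<^bsub>ext\<^esub> u \<otimes>\<^bsub>ext\<^esub> (u \<circ>\<^bsub>ext\<^esub> w) = u \<circ>\<^bsub>ext\<^esub> v \<otimes>\<^bsub>ext\<^esub> ?t"
    proof -
      have "u \<circ>\<^bsub>ext\<^esub> v \<in> carrier ext"
        using c by (simp add: eq)
      then show ?thesis
        using inv_u uvw(1) t by (simp only: dot.m_assoc dot.inv_closed)
    qed
    also have "\<dots> = u \<circ>\<^bsub>ext\<^esub> (v \<otimes>\<^bsub>ext\<^esub> w)"
    proof -
      have dot: "x \<circ>\<^bsub>K\<^esub> y \<otimes>\<^bsub>K\<^esub> ?l = x \<circ>\<^bsub>K\<^esub> (y \<otimes>\<^bsub>K\<^esub> z)"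
        using c by (simp add: K.brace_distrib brace_lambda_def K.dot.m_assoc)
      have "a \<otimes>\<^bsub>A\<^esub> b \<otimes>\<^bsub>A\<^esub> \<mu> (x, y) \<otimes>\<^bsub>A\<^esub> (c \<otimes>\<^bsub>A\<^esub> \<mu> (x, z) \<otimes>\<^bsub>A\<^esub> inv\<^bsub>A\<^esub> \<alpha> (x, ?l)) \<otimes>\<^bsub>A\<^esub> \<alpha> (x \<circ>\<^bsub>K\<^esub> y, ?l)
          = a \<otimes>\<^bsub>A\<^esub> b \<otimes>\<^bsub>A\<^esub> c \<otimes>\<^bsub>A\<^esub> (inv\<^bsub>A\<^esub> \<alpha> (x, ?l) \<otimes>\<^bsub>A\<^esub> (\<mu> (x, y) \<otimes>\<^bsub>A\<^esub> \<mu> (x, z) \<otimes>\<^bsub>A\<^esub> \<alpha> (x \<circ>\<^bsub>K\<^esub> y, ?l)))"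
        using c l(1) by (simp add: A.m_ac)
      also have "\<dots> = a \<otimes>\<^bsub>A\<^esub> b \<otimes>\<^bsub>A\<^esub> c \<otimes>\<^bsub>A\<^esub> (inv\<^bsub>A\<^esub> \<alpha> (x, ?l) \<otimes>\<^bsub>A\<^esub> (\<alpha> (y, z) \<otimes>\<^bsub>A\<^esub> \<alpha> (x, ?l) \<otimes>\<^bsub>A\<^esub> \<mu> (x, y \<otimes>\<^bsub>K\<^esub> z)))"
        using c by (simp add: cocycle_mixed)
      also have "\<dots> = a \<otimes>\<^bsub>A\<^esub> (b \<otimes>\<^bsub>A\<^esub> c \<otimes>\<^bsub>A\<^esub> \<alpha> (y, z)) \<otimes>\<^bsub>A\<^esub> \<mu> (x, y \<otimes>\<^bsub>K\<^esub> z)"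
        using c l(1) by (simp add: A.m_ac A.conjugate_eq)
      finally show ?thesis
        by (simp add: eq dot)
    qed
    finally show "u \<circ>\<^bsub>ext\<^esub> (v \<otimes>\<^bsub>ext\<^esub> w) = u \<circ>\<^bsub>ext\<^esub> v \<otimes>\<^bsub>ext\<^esub> inv\<^bsub>ext\<^esub> u \<otimes>\<^bsub>ext\<^esub> (u \<circ>\<^bsub>ext\<^esub> w)"
      by simp
  qed
qed

end

section \<open>Cohomologous characters and the fibre product\<close>

text \<open>
  Equal cosets of the coboundaries have representatives that differ by the coboundary of some \<open>h\<close>.
  One \<open>h\<close> serves both components, and this is what later yields a homomorphism for both operations.
\<close>

lemma eps_eq_imp_cochain:
  assumes K: "skew_brace K" and eq: "eps K (\<alpha>, \<mu>) \<chi> = eps K (\<beta>, \<nu>) \<eta>"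
  obtains h where "h \<in> carrier K \<rightarrow> carrier complex_units" "h \<one>\<^bsub>K\<^esub> = 1"
    "\<And>x y. \<lbrakk>x \<in> carrier K; y \<in> carrier K\<rbrakk> \<Longrightarrow>
      \<chi> (\<alpha> (x, y)) * h (x \<otimes>\<^bsub>K\<^esub> y) = h x * h y * \<eta> (\<beta> (x, y))"
    "\<And>x y. \<lbrakk>x \<in> carrier K; y \<in> carrier K\<rbrakk> \<Longrightarrow>
      \<chi> (\<mu> (x, y)) * h (x \<circ>\<^bsub>K\<^esub> y) = h x * h y * \<eta> (\<nu> (x, y))"
proof -
  interpret K: skew_brace K by (rule K)
  let ?KK = "carrier K \<times> carrier K"
  let ?c = "(\<lambda>p \<in> ?KK. \<chi> (\<alpha> p), \<lambda>p \<in> ?KK. \<chi> (\<mu> p))"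
  let ?d = "(\<lambda>p \<in> ?KK. \<eta> (\<beta> p), \<lambda>p \<in> ?KK. \<eta> (\<nu> p))"
  let ?\<delta> = "\<lambda>h. (\<lambda>(x, y) \<in> ?KK. h x \<otimes>\<^bsub>complex_units\<^esub> h y \<otimes>\<^bsub>complex_units\<^esub> inv\<^bsub>complex_units\<^esub> h (x \<otimes>\<^bsub>K\<^esub> y),
       \<lambda>(x, y) \<in> ?KK. h x \<otimes>\<^bsub>complex_units\<^esub> h y \<otimes>\<^bsub>complex_units\<^esub> inv\<^bsub>complex_units\<^esub> h (x \<circ>\<^bsub>K\<^esub> y))"
  have "?\<delta> (\<lambda>_. 1) \<in> coboundaries2 K complex_units"
    unfolding coboundaries2_def by (intro CollectI exI[of _ "\<lambda>_. 1"]) auto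
  moreover have "?c = ?\<delta> (\<lambda>_. 1) \<otimes>\<^bsub>cocycle_group K complex_units\<^esub> ?c"
    by (auto simp: cocycle_group_def fun_eq_iff)
  ultimately have "?c \<in> cohomology_class K complex_units ?c"
    unfolding cohomology_class_def r_coset_def by blast
  with eq have "?c \<in> cohomology_class K complex_units ?d"
    by (simp add: eps_def)
  then obtain h where h: "h \<in> carrier K \<rightarrow> carrier complex_units" "h \<one>\<^bsub>K\<^esub> = 1"
    and c: "?c = ?\<delta> h \<otimes>\<^bsub>cocycle_group K complex_units\<^esub> ?d"
    unfolding cohomology_class_def r_coset_def coboundaries2_def by auto
  have h0: "h x \<noteq> 0" if "x \<in> carrier K" for x
    using h that by auto
  show thesis
  proof (rule that[OF h])
    fix x y assume xy: "x \<in> carrier K" "y \<in> carrier K"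
    have "fst ?c (x, y) = fst (?\<delta> h \<otimes>\<^bsub>cocycle_group K complex_units\<^esub> ?d) (x, y)"
      by (simp only: c)
    then show "\<chi> (\<alpha> (x, y)) * h (x \<otimes>\<^bsub>K\<^esub> y) = h x * h y * \<eta> (\<beta> (x, y))"
      using xy h0[OF K.dot.m_closed[OF xy]] by (simp add: cocycle_group_def)
    have "snd ?c (x, y) = snd (?\<delta> h \<otimes>\<^bsub>cocycle_group K complex_units\<^esub> ?d) (x, y)"
      by (simp only: c)
    then show "\<chi> (\<mu> (x, y)) * h (x \<circ>\<^bsub>K\<^esub> y) = h x * h y * \<eta> (\<nu> (x, y))"
      using xy h0[OF K.circ_closed[OF xy]] by (simp add: cocycle_group_def)
  qed
qed

text \<open>
  The cochain with values in \<open>A \<times> B\<close> that classifies the fibre product of two extensions of \<open>K\<close>.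
  It is restricted to \<open>K \<times> K\<close> because cocycles are extensional.
\<close>

definition pair_cochain ::
    "('k, 'm) skew_brace_scheme \<Rightarrow> ('k \<times> 'k \<Rightarrow> 'a) \<Rightarrow> ('k \<times> 'k \<Rightarrow> 'b) \<Rightarrow> 'k \<times> 'k \<Rightarrow> 'a \<times> 'b" where
  "pair_cochain K f g = (\<lambda>p \<in> carrier K \<times> carrier K. (f p, g p))"

lemma pair_cochain_apply [simp]:
  "\<lbrakk>x \<in> carrier K; y \<in> carrier K\<rbrakk> \<Longrightarrow> pair_cochain K f g (x, y) = (f (x, y), g (x, y))"
  by (simp add: pair_cochain_def)

locale cocycle_pair =
  A: brace_cocycle A K \<alpha> \<mu> + B: brace_cocycle B K \<beta> \<nu>
  for A :: "'a monoid" and B :: "'b monoid" and K :: "'k skew_brace"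
    and \<alpha> \<mu> :: "'k \<times> 'k \<Rightarrow> 'a" and \<beta> \<nu> :: "'k \<times> 'k \<Rightarrow> 'b"
begin

lemma pair_cochain_cocycle:
  "(pair_cochain K \<alpha> \<beta>, pair_cochain K \<mu> \<nu>) \<in> cocycles2 K (A \<times>\<times> B)"
proof -
  have "pair_cochain K f g \<in> carrier K \<times> carrier K \<rightarrow>\<^sub>E carrier (A \<times>\<times> B)"
    if "f \<in> carrier K \<times> carrier K \<rightarrow>\<^sub>E carrier A" "g \<in> carrier K \<times> carrier K \<rightarrow>\<^sub>E carrier B" for f g
    using that by (auto simp: pair_cochain_def)
  then show ?thesis
    using A.cocycle B.cocycle A.A.is_group B.A.is_group by (simp add: cocycles2_def)
qed

sublocale AB: abelian_pair A B
  by unfold_locales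

sublocale E: brace_cocycle "A \<times>\<times> B" K "pair_cochain K \<alpha> \<beta>" "pair_cochain K \<mu> \<nu>"
  by unfold_locales (rule pair_cochain_cocycle)

lemma brace_epi_left: "brace_epi E.ext A.ext (\<lambda>((a, b), x). (a, x))"
proof (intro brace_epi.intro brace_epi_axioms.intro E.skew_brace_ext A.skew_brace_ext)
  show "(\<lambda>((a, b), x). (a, x)) ` carrier E.ext = carrier A.ext"
    using B.A.one_closed by (force simp: image_iff)
qed (auto simp: hom_def)

lemma brace_epi_right: "brace_epi E.ext B.ext (\<lambda>((a, b), x). (b, x))"
proof (intro brace_epi.intro brace_epi_axioms.intro E.skew_brace_ext B.skew_brace_ext)
  show "(\<lambda>((a, b), x). (b, x)) ` carrier E.ext = carrier B.ext"
    using A.A.one_closed by (force simp: image_iff)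
qed (auto simp: hom_def)

text \<open>
  Let \<open>h\<close> be a cochain whose coboundary is the quotient of the two cocycles pushed to the complex
  numbers. Then \<open>((a, b), x) \<mapsto> \<chi> a h(x) / \<eta> b\<close> respects both operations of the fibre product,
  for \<open>h\<close> absorbs exactly the contributions of the cocycles. Being a brace homomorphism to an
  abelian group, it is trivial on \<open>Gamma2\<close>, and \<open>h(1) = 1\<close>.
\<close>

lemma Gamma2_characters_agree:
  assumes \<chi>: "\<chi> \<in> characters A" and \<eta>: "\<eta> \<in> characters B"
    and eq: "eps K (\<alpha>, \<mu>) \<chi> = eps K (\<beta>, \<nu>) \<eta>"
    and u: "((a, b), \<one>\<^bsub>K\<^esub>) \<in> Gamma2 E.ext"
  shows "\<chi> a = \<eta> b"
proof -
  interpret E': skew_brace E.ext by (rule E.skew_brace_ext)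
  obtain h where h: "h \<in> carrier K \<rightarrow> carrier complex_units" "h \<one>\<^bsub>K\<^esub> = 1"
    and h_dot: "\<And>x y. \<lbrakk>x \<in> carrier K; y \<in> carrier K\<rbrakk> \<Longrightarrow>
      \<chi> (\<alpha> (x, y)) * h (x \<otimes>\<^bsub>K\<^esub> y) = h x * h y * \<eta> (\<beta> (x, y))"
    and h_circ: "\<And>x y. \<lbrakk>x \<in> carrier K; y \<in> carrier K\<rbrakk> \<Longrightarrow>
      \<chi> (\<mu> (x, y)) * h (x \<circ>\<^bsub>K\<^esub> y) = h x * h y * \<eta> (\<nu> (x, y))"
    using eps_eq_imp_cochain[OF A.K.skew_brace_axioms eq] by metis
  have h0: "h x \<noteq> 0" if "x \<in> carrier K" for x
    using h that by auto
  define \<phi> where "\<phi> = (\<lambda>((a, b), x). \<chi> a * h x / \<eta> b)"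
  \<comment> \<open>The defect \<open>c\<close>, \<open>d\<close> of the two cocycles is compensated by the values of \<open>h\<close> at the two
    arguments and at their product.\<close>
  have twist: "c1 * c2 * c * h3 / (d1 * d2 * d) = (c1 * h1 / d1) * (c2 * h2 / d2)"
    if "c * h3 = h1 * h2 * d" "d \<noteq> 0" for c c1 c2 d d1 d2 h1 h2 h3 :: complex
  proof -
    have "c1 * c2 * c * h3 / (d1 * d2 * d) = c1 * c2 * (c * h3) / (d1 * d2 * d)"
      by (simp add: mult.assoc)
    then show ?thesis
      unfolding that(1) using that(2) by simp
  qed
  have "\<phi> \<in> hom E.ext complex_units" "\<phi> \<in> hom (circ_group E.ext) complex_units"
    by (auto simp: hom_def \<phi>_def h0 character_nonzero[OF \<chi>] character_nonzero[OF \<eta>]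
      character_mult[OF \<chi>] character_mult[OF \<eta>] twist[OF h_dot] twist[OF h_circ])
  then have "\<phi> ((a, b), \<one>\<^bsub>K\<^esub>) = 1"
    using E'.hom_to_comm_group_Gamma2[OF comm_group_complex_units _ _ u] by simp
  moreover have "b \<in> carrier B"
    using E'.Gamma2_in_carrier[OF u] by simp
  ultimately show ?thesis
    using character_nonzero[OF \<eta>] h(2) by (simp add: \<phi>_def)
qed

end

text \<open>
  Each half of the hypothesis on the images of the characters handles one of the two kernels.
\<close>

theorem theoremA:
  fixes K :: "'k skew_brace" and A :: "'a monoid" and B :: "'b monoid"
    and \<alpha> \<mu> :: "'k \<times> 'k \<Rightarrow> 'a" and \<beta> \<nu> :: "'k \<times> 'k \<Rightarrow> 'b"
  assumes "skew_brace K" and "finite (carrier K)"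
    and "comm_group A" and "comm_group B"
    and "(\<alpha>, \<mu>) \<in> cocycles2 K A" and "(\<beta>, \<nu>) \<in> cocycles2 K B"
    and "eps K (\<alpha>, \<mu>) ` characters A = eps K (\<beta>, \<nu>) ` characters B"
  shows "isoclinic (annihilator_extension A K (\<alpha>, \<mu>)) (annihilator_extension B K (\<beta>, \<nu>))"
proof -
  interpret A: comm_group A by fact
  interpret B: comm_group B by fact
  interpret K: skew_brace K by fact
  interpret cocycle_pair A B K \<alpha> \<mu> \<beta> \<nu>
    by unfold_locales fact+
  interpret E': skew_brace E.ext by (rule E.skew_brace_ext)
  interpret left: brace_epi E.ext A.ext "\<lambda>((a, b), x). (a, x)"
    by (rule brace_epi_left)
  interpret right: brace_epi E.ext B.ext "\<lambda>((a, b), x). (b, x)"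
    by (rule brace_epi_right)
  have "b = \<one>\<^bsub>B\<^esub>" if u: "((\<one>\<^bsub>A\<^esub>, b), \<one>\<^bsub>K\<^esub>) \<in> Gamma2 E.ext" for b
  proof (rule characters_separate_points[OF \<open>comm_group B\<close>])
    show "b \<in> carrier B"
      using E'.Gamma2_in_carrier[OF u] by simp
    fix \<eta> assume \<eta>: "\<eta> \<in> characters B"
    then obtain \<chi> where \<chi>: "\<chi> \<in> characters A" "eps K (\<alpha>, \<mu>) \<chi> = eps K (\<beta>, \<nu>) \<eta>"
      using assms(7) by (metis imageE imageI)
    then show "\<eta> b = 1"
      using Gamma2_characters_agree[OF \<chi>(1) \<eta> \<chi>(2) u] character_one[OF A.is_group \<chi>(1)] by simp
  qed
  then have left: "isoclinic_epi E.ext A.ext (\<lambda>((a, b), x). (a, x))"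
    by unfold_locales auto
  have "a = \<one>\<^bsub>A\<^esub>" if u: "((a, \<one>\<^bsub>B\<^esub>), \<one>\<^bsub>K\<^esub>) \<in> Gamma2 E.ext" for a
  proof (rule characters_separate_points[OF \<open>comm_group A\<close>])
    show "a \<in> carrier A"
      using E'.Gamma2_in_carrier[OF u] by simp
    fix \<chi> assume \<chi>: "\<chi> \<in> characters A"
    then obtain \<eta> where \<eta>: "\<eta> \<in> characters B" "eps K (\<alpha>, \<mu>) \<chi> = eps K (\<beta>, \<nu>) \<eta>"
      using assms(7) by (metis imageE imageI)
    then show "\<chi> a = 1"
      using Gamma2_characters_agree[OF \<chi> \<eta> u] character_one[OF B.is_group \<eta>(1)] by simp
  qed
  then have right: "isoclinic_epi E.ext B.ext (\<lambda>((a, b), x). (b, x))"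
    by unfold_locales auto
  show ?thesis
    by (rule isoclinic_span[OF left right])
qed

end
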